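(* Let $Q$ be the quiver $a\xrightarrow{\alpha}b\xrightarrow{\beta}c\xrightarrow{\gamma}d$ and let $R$ consist of the single relation $\alpha\cdot\beta\cdot\gamma=0$. Consider the following morphisms in the abelian category $\mathrm{Adel}(\mathcal{C}(Q,R)^{\oplus})$, which assemble into one diagram. Rows: $$(0\to a\to 0)\xrightarrow{\{\alpha\}}(0\to b\to 0)\xrightarrow{\{\mathrm{id}_b\}}(a\xrightarrow{\alpha}b\to 0)\to 0,$$ $$0\to(0\to c\xrightarrow{\gamma}d)\xrightarrow{\{\mathrm{id}_c\}}(0\to c\to 0)\xrightarrow{\{\gamma\}}(0\to d\to 0).$$ Columns: $$0\to(0\to a\xrightarrow{\alpha\cdot\beta}c)\xrightarrow{\{\mathrm{id}_a\}}(0\to a\to 0)\xrightarrow{\{\alpha\cdot\beta\}}(0\to c\xrightarrow{\gamma}d)\xrightarrow{\{\mathrm{id}_c\}}(a\xrightarrow{\alpha\cdot\beta}c\xrightarrow{\gamma}d)\to 0,$$ $$0\to(0\to b\xrightarrow{\beta}c)\xrightarrow{\{\mathrm{id}_b\}}(0\to b\to 0)\xrightarrow{\{\beta\}}(0\to c\to 0)\xrightarrow{\{\mathrm{id}_c\}}(b\xrightarrow{\beta}c\to 0)\to 0,$$ $$0\to(a\xrightarrow{\alpha}b\xrightarrow{\beta\cdot\gamma}d)\xrightarrow{\{\mathrm{id}_b\}}(a\xrightarrow{\alpha}b\to 0)\xrightarrow{\{\beta\cdot\gamma\}}(0\to d\to 0)\xrightarrow{\{\mathrm{id}_d\}}(b\xrightarrow{\beta\cdot\gamma}d\to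 0)\to 0.$$ Snake sequence: $$(0\to a\xrightarrow{\alpha\cdot\beta}c)\xrightarrow{\{\alpha\}}(0\to b\xrightarrow{\beta}c)\xrightarrow{\{\mathrm{id}_b\}}(a\xrightarrow{\alpha}b\xrightarrow{\beta\cdot\gamma}d)\xrightarrow{\{\beta\}}(a\xrightarrow{\alpha\cdot\beta}c\xrightarrow{\gamma}d)\xrightarrow{\{\mathrm{id}_c\}}(b\xrightarrow{\beta}c\to 0)\xrightarrow{\{\gamma\}}(b\xrightarrow{\beta\cdot\gamma}d\to 0).$$ Then all these morphisms are well defined, the diagram they form commutes, its two rows and three columns are exact, and the snake sequence is exact (i.e. exact at its four inner objects).
   Context: Composition is written in diagrammatic order: $\alpha\cdot\beta$ means first $\alpha$, then $\beta$. For a quiver $Q$ and a set $R$ of $\mathbb{Z}$-linear relations between its paths, $\mathcal{C}(Q,R)$ is the $\mathbb{Z}$-linear category whose objects are the nodes of $Q$ and whose morphisms are $\mathbb{Z}$-linear combinations of paths of $Q$ modulo the relations $R$. For a $\mathbb{Z}$-linear category $\mathbf{C}$, $\mathbf{C}^{\oplus}$ is its additive closure: objects are finite (possibly empty) tuples of objects of $\mathbf{C}$ (formal direct sums) and morphisms are matrices of morphisms of $\mathbf{C}$. The Adelman category $\mathrm{Adel}(\mathbf{A})$ of an additive category $\mathbf{A}$: its objects are composable pairs $(r_x\xrightarrow{\rho_x}x\xrightarrow{\gamma_x}c_x)$ of morphisms in $\mathbf{A}$ (no condition on $\rho_x\cdot\gamma_x$). A morphism, written $\{\varphi\}$, from $(r_x\xrightarrow{\rho_x}x\xrightarrow{\gamma_x}c_x)$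 to $(r_y\xrightarrow{\rho_y}y\xrightarrow{\gamma_y}c_y)$ is given by a morphism $\varphi:x\to y$ in $\mathbf{A}$ such that there exist $\omega: r_x\to r_y$ and $\psi: c_x\to c_y$ with $\rho_x\cdot\varphi=\omega\cdot\rho_y$ and $\gamma_x\cdot\psi=\varphi\cdot\gamma_y$; two such morphisms $\{\varphi\},\{\varphi'\}$ are equal if there exist $\sigma_1: x\to r_y$ and $\sigma_2:c_x\to y$ with $\varphi-\varphi'=\sigma_1\cdot\rho_y+\gamma_x\cdot\sigma_2$. Composition and addition are induced from $\mathbf{A}$. $\mathrm{Adel}(\mathbf{A})$ is an abelian category. *)

theory Defs
  imports "HOL-Library.Poly_Mapping" "Jordan_Normal_Form.Matrix"
begin

section \<open>Linear categories\<close>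

text \<open>
  The operations are indexed by objects, since a morphism need not determine its source and
  target. Composition is diagrammatic: \<open>ccomp C x y z f g\<close> is \<open>f: x \<rightarrow> y\<close> followed by
  \<open>g: y \<rightarrow> z\<close>.
\<close>

record ('o, 'm) lincat =
  cobj :: "'o set"
  chom :: "'o \<Rightarrow> 'o \<Rightarrow> 'm set"
  ccomp :: "'o \<Rightarrow> 'o \<Rightarrow> 'o \<Rightarrow> 'm \<Rightarrow> 'm \<Rightarrow> 'm"
  cid :: "'o \<Rightarrow> 'm"
  cadd :: "'o \<Rightarrow> 'o \<Rightarrow> 'm \<Rightarrow> 'm \<Rightarrow> 'm"
  cneg :: "'o \<Rightarrow> 'o \<Rightarrow> 'm \<Rightarrow> 'm"
  czero :: "'o \<Rightarrow> 'o \<Rightarrow> 'm"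

definition csub :: "('o, 'm) lincat \<Rightarrow> 'o \<Rightarrow> 'o \<Rightarrow> 'm \<Rightarrow> 'm \<Rightarrow> 'm" where
  "csub C x y f g = cadd C x y f (cneg C x y g)"

definition csum :: "('o, 'm) lincat \<Rightarrow> 'o \<Rightarrow> 'o \<Rightarrow> 'm list \<Rightarrow> 'm" where
  "csum C x y fs = foldr (cadd C x y) fs (czero C x y)"

definition is_kernel :: "('o, 'm) lincat \<Rightarrow> 'o \<Rightarrow> 'o \<Rightarrow> 'm \<Rightarrow> 'o \<Rightarrow> 'm \<Rightarrow> bool" where
  "is_kernel C x y f k i \<longleftrightarrow>
     k \<in> cobj C \<and> i \<in> chom C k x \<and> ccomp C k x y i f = czero C k y \<and>
     (\<forall>t \<in> cobj C. \<forall>h \<in> chom C t x. ccomp C t x y h f = czero C t y \<longrightarrow>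
        (\<exists>!u. u \<in> chom C t k \<and> ccomp C t k x u i = h))"

definition is_cokernel :: "('o, 'm) lincat \<Rightarrow> 'o \<Rightarrow> 'o \<Rightarrow> 'm \<Rightarrow> 'o \<Rightarrow> 'm \<Rightarrow> bool" where
  "is_cokernel C x y f q p \<longleftrightarrow>
     q \<in> cobj C \<and> p \<in> chom C y q \<and> ccomp C x y q f p = czero C x q \<and>
     (\<forall>t \<in> cobj C. \<forall>h \<in> chom C y t. ccomp C x y t f h = czero C x t \<longrightarrow>
        (\<exists>!u. u \<in> chom C q t \<and> ccomp C y q t p u = h))"

definition is_image :: "('o, 'm) lincat \<Rightarrow> 'o \<Rightarrow> 'o \<Rightarrow> 'm \<Rightarrow> 'o \<Rightarrow> 'm \<Rightarrow> bool" where
  "is_image C x y f k i \<longleftrightarrow>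
     (\<exists>q p. is_cokernel C x y f q p \<and> is_kernel C y q p k i)"

text \<open>
  Exactness of \<open>x \<rightarrow> y \<rightarrow> z\<close> at \<open>y\<close>: image and kernel agree as subobjects of \<open>y\<close>.
\<close>

definition exact_at ::
    "('o, 'm) lincat \<Rightarrow> 'o \<Rightarrow> 'o \<Rightarrow> 'o \<Rightarrow> 'm \<Rightarrow> 'm \<Rightarrow> bool" where
  "exact_at C x y z f g \<longleftrightarrow> (\<exists>k i. is_image C x y f k i \<and> is_kernel C y z g k i)"


section \<open>Quivers, commutative diagrams, categories given by a quiver with relations\<close>

record ('n, 'e) quiver =
  nodes :: "'n set"
  arrows :: "'e set"
  src :: "'e \<Rightarrow> 'n"
  tgt :: "'e \<Rightarrow> 'n"

fun qpath :: "('n, 'e) quiver \<Rightarrow> 'n \<Rightarrow> 'e list \<Rightarrow> 'n \<Rightarrow> bool" where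
  "qpath Q x [] y \<longleftrightarrow> x \<in> nodes Q \<and> x = y"
| "qpath Q x (e # es) y \<longleftrightarrow> x \<in> nodes Q \<and> e \<in> arrows Q \<and> src Q e = x \<and> qpath Q (tgt Q e) es y"

text \<open>
  A diagram of shape \<open>Q\<close> in \<open>C\<close> is given by its objects \<open>ob\<close> and morphisms \<open>mor\<close>;
  it commutes iff any two parallel paths of \<open>Q\<close> have equal composites.
\<close>

fun composite :: "('o, 'm) lincat \<Rightarrow> ('n, 'e) quiver \<Rightarrow> ('n \<Rightarrow> 'o) \<Rightarrow> ('e \<Rightarrow> 'm) \<Rightarrow>
    'n \<Rightarrow> 'e list \<Rightarrow> 'n \<Rightarrow> 'm" where
  "composite C Q ob mor x [] y = cid C (ob x)"
| "composite C Q ob mor x (e # es) y =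
     ccomp C (ob x) (ob (tgt Q e)) (ob y) (mor e) (composite C Q ob mor (tgt Q e) es y)"

definition commutes :: "('o, 'm) lincat \<Rightarrow> ('n, 'e) quiver \<Rightarrow> ('n \<Rightarrow> 'o) \<Rightarrow> ('e \<Rightarrow> 'm) \<Rightarrow> bool" where
  "commutes C Q ob mor \<longleftrightarrow>
     (\<forall>x y p q. qpath Q x p y \<and> qpath Q x q y \<longrightarrow>
        composite C Q ob mor x p y = composite C Q ob mor x q y)"

text \<open>
  Since hom-sets are indexed by source and target, a path is encoded by its list of arrows only;
  the empty list serves as the trivial path at every node.
\<close>

definition lin_paths :: "('n, 'e) quiver \<Rightarrow> 'n \<Rightarrow> 'n \<Rightarrow> ('e list \<Rightarrow>\<^sub>0 int) set" where
  "lin_paths Q x y = {f. \<forall>p \<in> Poly_Mapping.keys f. qpath Q x p y}"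

definition path_mult :: "('e list \<Rightarrow>\<^sub>0 int) \<Rightarrow> ('e list \<Rightarrow>\<^sub>0 int) \<Rightarrow> ('e list \<Rightarrow>\<^sub>0 int)" where
  "path_mult f g =
     (\<Sum>p \<in> Poly_Mapping.keys f. \<Sum>q \<in> Poly_Mapping.keys g.
        Poly_Mapping.single (p @ q) (Poly_Mapping.lookup f p * Poly_Mapping.lookup g q))"

text \<open>
  A relation \<open>r = 0\<close> with \<open>r \<in> lin_paths Q x y\<close> is encoded as \<open>(x, y, r) \<in> R\<close>;
  \<open>rel_ideal Q R x y\<close> is the component at \<open>(x, y)\<close> of the two-sided ideal generated by \<open>R\<close>.
\<close>

inductive rel_ideal ::
    "('n, 'e) quiver \<Rightarrow> ('n \<times> 'n \<times> ('e list \<Rightarrow>\<^sub>0 int)) set \<Rightarrow> 'n \<Rightarrow> 'n \<Rightarrow> ('e list \<Rightarrow>\<^sub>0 int) \<Rightarrow> bool"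
  for Q R where
  gen: "(x, y, r) \<in> R \<Longrightarrow> rel_ideal Q R x y r"
| zero: "rel_ideal Q R x y 0"
| diff: "rel_ideal Q R x y f \<Longrightarrow> rel_ideal Q R x y g \<Longrightarrow> rel_ideal Q R x y (f - g)"
| left: "f \<in> lin_paths Q x y \<Longrightarrow> rel_ideal Q R y z g \<Longrightarrow> rel_ideal Q R x z (path_mult f g)"
| right: "rel_ideal Q R x y f \<Longrightarrow> g \<in> lin_paths Q y z \<Longrightarrow> rel_ideal Q R x z (path_mult f g)"

definition path_eq ::
    "('n, 'e) quiver \<Rightarrow> ('n \<times> 'n \<times> ('e list \<Rightarrow>\<^sub>0 int)) set \<Rightarrow> 'n \<Rightarrow> 'n \<Rightarrow> ('e list \<Rightarrow>\<^sub>0 int) rel" where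
  "path_eq Q R x y =
     {(f, g). f \<in> lin_paths Q x y \<and> g \<in> lin_paths Q x y \<and> rel_ideal Q R x y (f - g)}"

definition path_class ::
    "('n, 'e) quiver \<Rightarrow> ('n \<times> 'n \<times> ('e list \<Rightarrow>\<^sub>0 int)) set \<Rightarrow> 'n \<Rightarrow> 'n \<Rightarrow>
     ('e list \<Rightarrow>\<^sub>0 int) \<Rightarrow> ('e list \<Rightarrow>\<^sub>0 int) set" where
  "path_class Q R x y f = path_eq Q R x y `` {f}"

definition path_cat ::
    "('n, 'e) quiver \<Rightarrow> ('n \<times> 'n \<times> ('e list \<Rightarrow>\<^sub>0 int)) set \<Rightarrow> ('n, ('e list \<Rightarrow>\<^sub>0 int) set) lincat" where
  "path_cat Q R = \<lparr>
     cobj = nodes Q,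
     chom = (\<lambda>x y. lin_paths Q x y // path_eq Q R x y),
     ccomp = (\<lambda>x y z F G. \<Union>f \<in> F. \<Union>g \<in> G. path_class Q R x z (path_mult f g)),
     cid = (\<lambda>x. path_class Q R x x (Poly_Mapping.single [] 1)),
     cadd = (\<lambda>x y F G. \<Union>f \<in> F. \<Union>g \<in> G. path_class Q R x y (f + g)),
     cneg = (\<lambda>x y F. \<Union>f \<in> F. path_class Q R x y (- f)),
     czero = (\<lambda>x y. path_class Q R x y 0) \<rparr>"


section \<open>Additive closure\<close>

text \<open>
  As composition is diagrammatic, a morphism of tuples is a matrix with rows indexed by the source
  and columns indexed by the target.
\<close>

definition add_closure :: "('o, 'm) lincat \<Rightarrow> ('o list, 'm mat) lincat" where
  "add_closure C = \<lparr>
     cobj = lists (cobj C),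
     chom = (\<lambda>xs ys. {M \<in> carrier_mat (length xs) (length ys).
        \<forall>i < length xs. \<forall>j < length ys. M $$ (i, j) \<in> chom C (xs ! i) (ys ! j)}),
     ccomp = (\<lambda>xs ys zs M N. mat (length xs) (length zs) (\<lambda>(i, j).
        csum C (xs ! i) (zs ! j)
          (map (\<lambda>k. ccomp C (xs ! i) (ys ! k) (zs ! j) (M $$ (i, k)) (N $$ (k, j)))
             [0..<length ys]))),
     cid = (\<lambda>xs. mat (length xs) (length xs) (\<lambda>(i, j).
        if i = j then cid C (xs ! i) else czero C (xs ! i) (xs ! j))),
     cadd = (\<lambda>xs ys M N. mat (length xs) (length ys) (\<lambda>(i, j).
        cadd C (xs ! i) (ys ! j) (M $$ (i, j)) (N $$ (i, j)))),
     cneg = (\<lambda>xs ys M. mat (length xs) (length ys) (\<lambda>(i, j).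
        cneg C (xs ! i) (ys ! j) (M $$ (i, j)))),
     czero = (\<lambda>xs ys. mat (length xs) (length ys) (\<lambda>(i, j). czero C (xs ! i) (ys ! j))) \<rparr>"


section \<open>The Adelman category\<close>

text \<open>\<open>AdOb r \<rho> x \<gamma> c\<close> is the composable pair \<open>\<rho>: r \<rightarrow> x\<close>, \<open>\<gamma>: x \<rightarrow> c\<close>.\<close>

datatype ('o, 'm) adob = AdOb (ad_r: 'o) (ad_rho: 'm) (ad_mid: 'o) (ad_gam: 'm) (ad_c: 'o)

definition adel_obj :: "('o, 'm) lincat \<Rightarrow> ('o, 'm) adob set" where
  "adel_obj A = {X. ad_r X \<in> cobj A \<and> ad_mid X \<in> cobj A \<and> ad_c X \<in> cobj A \<and>
     ad_rho X \<in> chom A (ad_r X) (ad_mid X) \<and> ad_gam X \<in> chom A (ad_mid X) (ad_c X)}"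

text \<open>The \<open>\<phi>\<close> for which \<open>{\<phi>}\<close> is a well-defined morphism from \<open>X\<close> to \<open>Y\<close>.\<close>

definition adel_rep :: "('o, 'm) lincat \<Rightarrow> ('o, 'm) adob \<Rightarrow> ('o, 'm) adob \<Rightarrow> 'm set" where
  "adel_rep A X Y = {\<phi> \<in> chom A (ad_mid X) (ad_mid Y).
     \<exists>\<omega> \<in> chom A (ad_r X) (ad_r Y). \<exists>\<psi> \<in> chom A (ad_c X) (ad_c Y).
       ccomp A (ad_r X) (ad_mid X) (ad_mid Y) (ad_rho X) \<phi> =
         ccomp A (ad_r X) (ad_r Y) (ad_mid Y) \<omega> (ad_rho Y) \<and>
       ccomp A (ad_mid X) (ad_c X) (ad_c Y) (ad_gam X) \<psi> =
         ccomp A (ad_mid X) (ad_mid Y) (ad_c Y) \<phi> (ad_gam Y)}"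

definition adel_eq :: "('o, 'm) lincat \<Rightarrow> ('o, 'm) adob \<Rightarrow> ('o, 'm) adob \<Rightarrow> 'm rel" where
  "adel_eq A X Y = {(\<phi>, \<phi>'). \<phi> \<in> adel_rep A X Y \<and> \<phi>' \<in> adel_rep A X Y \<and>
     (\<exists>\<sigma>1 \<in> chom A (ad_mid X) (ad_r Y). \<exists>\<sigma>2 \<in> chom A (ad_c X) (ad_mid Y).
       csub A (ad_mid X) (ad_mid Y) \<phi> \<phi>' =
         cadd A (ad_mid X) (ad_mid Y)
           (ccomp A (ad_mid X) (ad_r Y) (ad_mid Y) \<sigma>1 (ad_rho Y))
           (ccomp A (ad_mid X) (ad_c X) (ad_mid Y) (ad_gam X) \<sigma>2))}"

definition adel_class :: "('o, 'm) lincat \<Rightarrow> ('o, 'm) adob \<Rightarrow> ('o, 'm) adob \<Rightarrow> 'm \<Rightarrow> 'm set" where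
  "adel_class A X Y \<phi> = adel_eq A X Y `` {\<phi>}"

definition adel :: "('o, 'm) lincat \<Rightarrow> (('o, 'm) adob, 'm set) lincat" where
  "adel A = \<lparr>
     cobj = adel_obj A,
     chom = (\<lambda>X Y. adel_rep A X Y // adel_eq A X Y),
     ccomp = (\<lambda>X Y Z F G. \<Union>f \<in> F. \<Union>g \<in> G.
        adel_class A X Z (ccomp A (ad_mid X) (ad_mid Y) (ad_mid Z) f g)),
     cid = (\<lambda>X. adel_class A X X (cid A (ad_mid X))),
     cadd = (\<lambda>X Y F G. \<Union>f \<in> F. \<Union>g \<in> G.
        adel_class A X Y (cadd A (ad_mid X) (ad_mid Y) f g)),
     cneg = (\<lambda>X Y F. \<Union>f \<in> F. adel_class A X Y (cneg A (ad_mid X) (ad_mid Y) f)),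
     czero = (\<lambda>X Y. adel_class A X Y (czero A (ad_mid X) (ad_mid Y))) \<rparr>"


section \<open>The snake\<close>

datatype snode = Na | Nb | Nc | Nd

datatype sarrow = Alpha | Beta | Gamma

definition snake_quiver :: "(snode, sarrow) quiver" where
  "snake_quiver = \<lparr>
     nodes = UNIV,
     arrows = UNIV,
     src = (\<lambda>e. case e of Alpha \<Rightarrow> Na | Beta \<Rightarrow> Nb | Gamma \<Rightarrow> Nc),
     tgt = (\<lambda>e. case e of Alpha \<Rightarrow> Nb | Beta \<Rightarrow> Nc | Gamma \<Rightarrow> Nd) \<rparr>"

definition snake_rel :: "(snode \<times> snode \<times> (sarrow list \<Rightarrow>\<^sub>0 int)) set" where
  "snake_rel = {(Na, Nd, Poly_Mapping.single [Alpha, Beta, Gamma] 1)}"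

type_synonym smor = "(sarrow list \<Rightarrow>\<^sub>0 int) set mat"

type_synonym sadob = "(snode list, smor) adob"

definition snakeA :: "(snode list, smor) lincat" where
  "snakeA = add_closure (path_cat snake_quiver snake_rel)"

definition arrow_mor :: "sarrow \<Rightarrow> smor" where
  "arrow_mor e = mat 1 1 (\<lambda>_. path_class snake_quiver snake_rel
     (src snake_quiver e) (tgt snake_quiver e) (Poly_Mapping.single [e] 1))"

abbreviation m_al :: smor where "m_al \<equiv> arrow_mor Alpha"
abbreviation m_be :: smor where "m_be \<equiv> arrow_mor Beta"
abbreviation m_ga :: smor where "m_ga \<equiv> arrow_mor Gamma"
abbreviation m_albe :: smor where "m_albe \<equiv> ccomp snakeA [Na] [Nb] [Nc] m_al m_be"
abbreviation m_bega :: smor where "m_bega \<equiv> ccomp snakeA [Nb] [Nc] [Nd] m_be m_ga"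

text \<open>The objects \<open>(0 \<rightarrow> x \<rightarrow> 0)\<close>, \<open>(0 \<rightarrow> x \<rightarrow> c)\<close> and \<open>(r \<rightarrow> x \<rightarrow> 0)\<close>.\<close>

abbreviation ob_0x0 :: "snode list \<Rightarrow> sadob" where
  "ob_0x0 x \<equiv> AdOb [] (czero snakeA [] x) x (czero snakeA x []) []"
abbreviation ob_0xc :: "snode list \<Rightarrow> smor \<Rightarrow> snode list \<Rightarrow> sadob" where
  "ob_0xc x g c \<equiv> AdOb [] (czero snakeA [] x) x g c"
abbreviation ob_rx0 :: "snode list \<Rightarrow> smor \<Rightarrow> snode list \<Rightarrow> sadob" where
  "ob_rx0 r f x \<equiv> AdOb r f x (czero snakeA x []) []"

text \<open>
  The positions in the snake diagram. From top to bottom its columns consist of \<open>Zt\<close> (zero),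
  \<open>K\<close>, \<open>U\<close> (upper row), \<open>L\<close> (lower row), \<open>C\<close> and \<open>Zb\<close> (zero); the zeros at the end of the
  upper row and at the start of the lower row are \<open>ZU\<close> and \<open>ZL\<close>. The zeros are distinct
  positions although they all carry the same object.
\<close>

datatype pos = Zt1 | Zt2 | Zt3 | K1 | K2 | K3 | U1 | U2 | U3 | ZU
  | ZL | L1 | L2 | L3 | C1 | C2 | C3 | Zb1 | Zb2 | Zb3

fun snake_ob :: "pos \<Rightarrow> sadob" where
  "snake_ob K1 = ob_0xc [Na] m_albe [Nc]"
| "snake_ob K2 = ob_0xc [Nb] m_be [Nc]"
| "snake_ob K3 = AdOb [Na] m_al [Nb] m_bega [Nd]"
| "snake_ob U1 = ob_0x0 [Na]"
| "snake_ob U2 = ob_0x0 [Nb]"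
| "snake_ob U3 = ob_rx0 [Na] m_al [Nb]"
| "snake_ob L1 = ob_0xc [Nc] m_ga [Nd]"
| "snake_ob L2 = ob_0x0 [Nc]"
| "snake_ob L3 = ob_0x0 [Nd]"
| "snake_ob C1 = AdOb [Na] m_albe [Nc] m_ga [Nd]"
| "snake_ob C2 = ob_rx0 [Nb] m_be [Nc]"
| "snake_ob C3 = ob_rx0 [Nb] m_bega [Nd]"
| "snake_ob _ = ob_0x0 []"

text \<open>\<open>(m, \<phi>, n)\<close> stands for the morphism \<open>{\<phi>}\<close> from \<open>snake_ob m\<close> to \<open>snake_ob n\<close>.\<close>

type_synonym darrow = "pos \<times> smor \<times> pos"

abbreviation upper_row :: "darrow list" where
  "upper_row \<equiv>
     [(U1, m_al, U2), (U2, cid snakeA [Nb], U3), (U3, czero snakeA [Nb] [], ZU)]"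

abbreviation lower_row :: "darrow list" where
  "lower_row \<equiv>
     [(ZL, czero snakeA [] [Nc], L1), (L1, cid snakeA [Nc], L2), (L2, m_ga, L3)]"

abbreviation column1 :: "darrow list" where
  "column1 \<equiv>
     [(Zt1, czero snakeA [] [Na], K1), (K1, cid snakeA [Na], U1), (U1, m_albe, L1),
      (L1, cid snakeA [Nc], C1), (C1, czero snakeA [Nc] [], Zb1)]"

abbreviation column2 :: "darrow list" where
  "column2 \<equiv>
     [(Zt2, czero snakeA [] [Nb], K2), (K2, cid snakeA [Nb], U2), (U2, m_be, L2),
      (L2, cid snakeA [Nc], C2), (C2, czero snakeA [Nc] [], Zb2)]"

abbreviation column3 :: "darrow list" where
  "column3 \<equiv>
     [(Zt3, czero snakeA [] [Nb], K3), (K3, cid snakeA [Nb], U3), (U3, m_bega, L3),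
      (L3, cid snakeA [Nd], C3), (C3, czero snakeA [Nd] [], Zb3)]"

abbreviation snake_seq :: "darrow list" where
  "snake_seq \<equiv>
     [(K1, m_al, K2), (K2, cid snakeA [Nb], K3), (K3, m_be, C1), (C1, cid snakeA [Nc], C2),
      (C2, m_ga, C3)]"

definition snake_shape :: "(pos, darrow) quiver" where
  "snake_shape = \<lparr>
     nodes = UNIV,
     arrows = set (upper_row @ lower_row @ column1 @ column2 @ column3 @ snake_seq),
     src = (\<lambda>(m, \<phi>, n). m),
     tgt = (\<lambda>(m, \<phi>, n). n) \<rparr>"

definition snake_mor :: "darrow \<Rightarrow> smor set" where
  "snake_mor = (\<lambda>(m, \<phi>, n). adel_class snakeA (snake_ob m) (snake_ob n) \<phi>)"

text \<open>Exactness at all inner objects of a sequence of composable morphisms.\<close>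

fun exact_seq :: "darrow list \<Rightarrow> bool" where
  "exact_seq (e # e' # es) \<longleftrightarrow>
     tgt snake_shape e = src snake_shape e' \<and>
     exact_at (adel snakeA) (snake_ob (src snake_shape e)) (snake_ob (tgt snake_shape e))
       (snake_ob (tgt snake_shape e')) (snake_mor e) (snake_mor e') \<and>
     exact_seq (e' # es)"
| "exact_seq _ \<longleftrightarrow> True"

end

theory Submission
  imports Defs
begin

text \<open>
  The statement holds in \<open>Adel(A)\<close> for every additive category \<open>A\<close> and every chain
  \<open>a \<rightarrow> b \<rightarrow> c \<rightarrow> d\<close> of morphisms \<open>\<alpha>, \<beta>, \<gamma>\<close> with \<open>\<alpha>\<beta>\<gamma> = 0\<close>, and the reason is that exactness in
  \<open>Adel(A)\<close> is a question of solving linear equations in \<open>A\<close>.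
  
  A morphism \<open>{\<phi>}\<close> from \<open>X = (r\<^sub>x \<rightarrow> x \<rightarrow> c\<^sub>x)\<close> to \<open>Y = (r\<^sub>y \<rightarrow> y \<rightarrow> c\<^sub>y)\<close> has a cokernel with middle
  object \<open>y \<oplus> c\<^sub>x\<close>, whose projection is the inclusion of \<open>y\<close>. Reading off the two components of
  \<open>y \<oplus> c\<^sub>x\<close>, the projection kills \<open>{h}: T \<rightarrow> Y\<close> iff \<open>h = a\<rho>\<^sub>y + a'\<phi> + \<gamma>\<^sub>t b\<close> for some \<open>a, a', b\<close>
  such that \<open>a'\<gamma>\<^sub>x = \<gamma>\<^sub>t b'\<close> for some \<open>b'\<close> (lemma \<open>adel_cokernel\<close>, predicate \<open>in_adel_image\<close>).
  Kernels exist by duality, as \<open>Adel(A\<^sup>o\<^sup>p)\<close> is the opposite of \<open>Adel(A)\<close>. Two morphisms out of \<open>Y\<close> that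
  kill the same \<open>{h}\<close> have the same kernel. Hence a sequence \<open>X \<rightarrow> Y \<rightarrow> Z\<close> with composite zero is
  exact once every \<open>{h}\<close> that becomes zero in \<open>Z\<close> has such an expression (lemma \<open>adel_exactI\<close>).
  
  All exactness claims then amount to writing down \<open>a, a', b, b'\<close>. The rows and columns are pieces
  of one sequence
  \<open>0 \<rightarrow> (r \<rightarrow> y \<rightarrow> z) \<rightarrow> (r \<rightarrow> y \<rightarrow> 0) \<rightarrow> (0 \<rightarrow> z \<rightarrow> c) \<rightarrow> (y \<rightarrow> z \<rightarrow> c) \<rightarrow> 0\<close>
  attached to a morphism \<open>g: y \<rightarrow> z\<close> with \<open>\<rho>g = 0\<close> and \<open>g\<gamma> = 0\<close> (lemma \<open>kernel_cokernel_sequence\<close>);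
  the relation \<open>\<alpha>\<beta>\<gamma> = 0\<close> supplies these equations for \<open>g = \<alpha>\<beta>\<close> and \<open>g = \<beta>\<gamma>\<close>. In the snake sequence
  the equations are solved by a subtraction: for example at \<open>(a \<rightarrow> b \<rightarrow> d)\<close>, if \<open>h\<beta> = s\<alpha>\<beta> + \<gamma>\<^sub>t u\<close> then
  \<open>k = h - s\<alpha>\<close> satisfies \<open>k\<beta> = \<gamma>\<^sub>t u\<close>, so \<open>h = s\<alpha> + k\<close> is the expression sought.
  
  It remains that \<open>C(Q,R)\<^sup>\<oplus>\<close> is additive (theorems \<open>preadditive_path_cat\<close> and
  \<open>additive_add_closure\<close>) and that the diagram commutes. For the latter, every arrow of the diagram is
  represented by the morphism that the unique path of \<open>Q\<close> between the middle objects defines, or by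
  zero; such morphisms compose, so a composite depends on its end points alone (lemma
  \<open>snake_composite\<close>).
\<close>

section \<open>Preadditive categories\<close>

text \<open>
  Hom-sets, sums and composites are families indexed by the whole type of objects, so the laws are
  asked for all indices, and only the identities refer to the set of objects. The infix notations
  carry the indices, since a morphism does not determine its source and target.
\<close>

locale preadditive_category =
  fixes C :: "('o, 'm) lincat"
  assumes add_closed [simp]: "f \<in> chom C x y \<Longrightarrow> g \<in> chom C x y \<Longrightarrow> cadd C x y f g \<in> chom C x y"
    and zero_closed [simp]: "czero C x y \<in> chom C x y"
    and neg_closed [simp]: "f \<in> chom C x y \<Longrightarrow> cneg C x y f \<in> chom C x y"
    and add_assoc: "f \<in> chom C x y \<Longrightarrow> g \<in> chom C x y \<Longrightarrow> h \<in> chom C x y \<Longrightarrow>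
      cadd C x y (cadd C x y f g) h = cadd C x y f (cadd C x y g h)"
    and add_comm: "f \<in> chom C x y \<Longrightarrow> g \<in> chom C x y \<Longrightarrow> cadd C x y f g = cadd C x y g f"
    and zero_add [simp]: "f \<in> chom C x y \<Longrightarrow> cadd C x y (czero C x y) f = f"
    and neg_add [simp]: "f \<in> chom C x y \<Longrightarrow> cadd C x y (cneg C x y f) f = czero C x y"
    and comp_closed [simp]:
      "f \<in> chom C x y \<Longrightarrow> g \<in> chom C y z \<Longrightarrow> ccomp C x y z f g \<in> chom C x z"
    and comp_assoc: "f \<in> chom C x y \<Longrightarrow> g \<in> chom C y z \<Longrightarrow> h \<in> chom C z w \<Longrightarrow>
      ccomp C x z w (ccomp C x y z f g) h = ccomp C x y w f (ccomp C y z w g h)"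
    and comp_add: "f \<in> chom C x y \<Longrightarrow> g \<in> chom C y z \<Longrightarrow> h \<in> chom C y z \<Longrightarrow>
      ccomp C x y z f (cadd C y z g h) = cadd C x z (ccomp C x y z f g) (ccomp C x y z f h)"
    and add_comp: "f \<in> chom C x y \<Longrightarrow> g \<in> chom C x y \<Longrightarrow> h \<in> chom C y z \<Longrightarrow>
      ccomp C x y z (cadd C x y f g) h = cadd C x z (ccomp C x y z f h) (ccomp C x y z g h)"
    and id_closed [simp]: "x \<in> cobj C \<Longrightarrow> cid C x \<in> chom C x x"
    and id_comp [simp]: "x \<in> cobj C \<Longrightarrow> f \<in> chom C x y \<Longrightarrow> ccomp C x x y (cid C x) f = f"
    and comp_id [simp]: "y \<in> cobj C \<Longrightarrow> f \<in> chom C x y \<Longrightarrow> ccomp C x y y f (cid C y) = f"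
begin

abbreviation hom :: "'o \<Rightarrow> 'o \<Rightarrow> 'm set" where
  "hom \<equiv> chom C"

abbreviation comp :: "'m \<Rightarrow> 'o \<Rightarrow> 'o \<Rightarrow> 'o \<Rightarrow> 'm \<Rightarrow> 'm"
    ("(_ \<cdot>\<^bsub>_,_,_\<^esub> _)" [71, 0, 0, 0, 70] 70) where
  "f \<cdot>\<^bsub>x,y,z\<^esub> g \<equiv> ccomp C x y z f g"

abbreviation plus :: "'m \<Rightarrow> 'o \<Rightarrow> 'o \<Rightarrow> 'm \<Rightarrow> 'm" ("(_ \<boxplus>\<^bsub>_,_\<^esub> _)" [66, 0, 0, 65] 65) where
  "f \<boxplus>\<^bsub>x,y\<^esub> g \<equiv> cadd C x y f g"

abbreviation neg :: "'o \<Rightarrow> 'o \<Rightarrow> 'm \<Rightarrow> 'm" where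
  "neg \<equiv> cneg C"

abbreviation zero :: "'o \<Rightarrow> 'o \<Rightarrow> 'm" where
  "zero \<equiv> czero C"

abbreviation one :: "'o \<Rightarrow> 'm" where
  "one \<equiv> cid C"

lemma add_zero [simp]: "f \<in> hom x y \<Longrightarrow> f \<boxplus>\<^bsub>x,y\<^esub> zero x y = f"
  using add_comm [of f x y "zero x y"] by simp

lemma add_neg [simp]: "f \<in> hom x y \<Longrightarrow> f \<boxplus>\<^bsub>x,y\<^esub> neg x y f = zero x y"
  using add_comm [of f x y "neg x y f"] by simp

lemma neg_add_cancel [simp]:
  "f \<in> hom x y \<Longrightarrow> g \<in> hom x y \<Longrightarrow> neg x y f \<boxplus>\<^bsub>x,y\<^esub> (f \<boxplus>\<^bsub>x,y\<^esub> g) = g"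
  using add_assoc [of "neg x y f" x y f g] by simp

lemma add_neg_cancel [simp]:
  "f \<in> hom x y \<Longrightarrow> g \<in> hom x y \<Longrightarrow> f \<boxplus>\<^bsub>x,y\<^esub> (neg x y f \<boxplus>\<^bsub>x,y\<^esub> g) = g"
  using add_assoc [of f x y "neg x y f" g] by simp

lemma add_left_comm:
  assumes "f \<in> hom x y" "g \<in> hom x y" "h \<in> hom x y"
  shows "f \<boxplus>\<^bsub>x,y\<^esub> (g \<boxplus>\<^bsub>x,y\<^esub> h) = g \<boxplus>\<^bsub>x,y\<^esub> (f \<boxplus>\<^bsub>x,y\<^esub> h)"
proof -
  have "f \<boxplus>\<^bsub>x,y\<^esub> (g \<boxplus>\<^bsub>x,y\<^esub> h) = (f \<boxplus>\<^bsub>x,y\<^esub> g) \<boxplus>\<^bsub>x,y\<^esub> h"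
    using assms by (simp add: add_assoc)
  also have "\<dots> = (g \<boxplus>\<^bsub>x,y\<^esub> f) \<boxplus>\<^bsub>x,y\<^esub> h"
    by (simp only: add_comm [OF assms(1,2)])
  also have "\<dots> = g \<boxplus>\<^bsub>x,y\<^esub> (f \<boxplus>\<^bsub>x,y\<^esub> h)"
    using assms by (simp add: add_assoc)
  finally show ?thesis .
qed

lemmas add_ac = add_assoc add_comm add_left_comm

lemma add_left_cancel:
  assumes "f \<in> hom x y" "g \<in> hom x y" "h \<in> hom x y" "f \<boxplus>\<^bsub>x,y\<^esub> g = f \<boxplus>\<^bsub>x,y\<^esub> h"
  shows "g = h"
proof -
  have "g = neg x y f \<boxplus>\<^bsub>x,y\<^esub> (f \<boxplus>\<^bsub>x,y\<^esub> g)"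
    using assms(1,2) by simp
  also have "\<dots> = neg x y f \<boxplus>\<^bsub>x,y\<^esub> (f \<boxplus>\<^bsub>x,y\<^esub> h)"
    by (simp only: assms(4))
  also have "\<dots> = h"
    using assms(1,3) by simp
  finally show ?thesis .
qed

lemma neg_unique:
  assumes "f \<in> hom x y" "g \<in> hom x y" "f \<boxplus>\<^bsub>x,y\<^esub> g = zero x y"
  shows "g = neg x y f"
  by (rule add_left_cancel [of f x y]) (use assms in simp_all)

lemma neg_zero [simp]: "neg x y (zero x y) = zero x y"
  by (rule neg_unique [symmetric]) simp_all

lemma neg_neg [simp]: "f \<in> hom x y \<Longrightarrow> neg x y (neg x y f) = f"
  by (rule neg_unique [symmetric]) simp_all

lemma neg_of_add:
  assumes "f \<in> hom x y" "g \<in> hom x y"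
  shows "neg x y (f \<boxplus>\<^bsub>x,y\<^esub> g) = neg x y f \<boxplus>\<^bsub>x,y\<^esub> neg x y g"
proof (rule neg_unique [symmetric])
  have "(f \<boxplus>\<^bsub>x,y\<^esub> g) \<boxplus>\<^bsub>x,y\<^esub> (neg x y f \<boxplus>\<^bsub>x,y\<^esub> neg x y g) =
    f \<boxplus>\<^bsub>x,y\<^esub> (neg x y f \<boxplus>\<^bsub>x,y\<^esub> (g \<boxplus>\<^bsub>x,y\<^esub> neg x y g))"
    using assms by (simp only: add_assoc add_closed neg_closed add_left_comm [of g x y "neg x y f"])
  then show "(f \<boxplus>\<^bsub>x,y\<^esub> g) \<boxplus>\<^bsub>x,y\<^esub> (neg x y f \<boxplus>\<^bsub>x,y\<^esub> neg x y g) = zero x y"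
    using assms by simp
qed (use assms in simp_all)

lemma comp_zero [simp]: "f \<in> hom x y \<Longrightarrow> f \<cdot>\<^bsub>x,y,z\<^esub> zero y z = zero x z"
  by (rule add_left_cancel [of "f \<cdot>\<^bsub>x,y,z\<^esub> zero y z" x z]) (simp_all flip: comp_add)

lemma zero_comp [simp]: "f \<in> hom y z \<Longrightarrow> zero x y \<cdot>\<^bsub>x,y,z\<^esub> f = zero x z"
  by (rule add_left_cancel [of "zero x y \<cdot>\<^bsub>x,y,z\<^esub> f" x z]) (simp_all flip: add_comp)

lemma comp_neg [simp]:
  "f \<in> hom x y \<Longrightarrow> g \<in> hom y z \<Longrightarrow> f \<cdot>\<^bsub>x,y,z\<^esub> neg y z g = neg x z (f \<cdot>\<^bsub>x,y,z\<^esub> g)"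
  by (rule neg_unique) (simp_all flip: comp_add)

lemma neg_comp [simp]:
  "f \<in> hom x y \<Longrightarrow> g \<in> hom y z \<Longrightarrow> neg x y f \<cdot>\<^bsub>x,y,z\<^esub> g = neg x z (f \<cdot>\<^bsub>x,y,z\<^esub> g)"
  by (rule neg_unique) (simp_all flip: add_comp)

lemma sub_closed [simp]:
  "f \<in> hom x y \<Longrightarrow> g \<in> hom x y \<Longrightarrow> csub C x y f g \<in> hom x y"
  by (simp add: csub_def)

end


section \<open>The category of a quiver with relations is preadditive\<close>

text \<open>
  Multiplication of linear combinations of paths is the bilinear extension of concatenation. In this
  form bilinearity is inherited from \<open>frag_extend\<close>, and identities such as associativity
  need only be checked on single paths, by induction over the free abelian group.
\<close>

lemma path_mult_eq_frag_extend:
  "path_mult f g = frag_extend (\<lambda>p. frag_extend (\<lambda>q. frag_of (p @ q)) g) f"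
proof -
  have "frag_cmul c (Poly_Mapping.single k d) = Poly_Mapping.single k (c * d)"
    for c d :: int and k :: "'a list"
    by (rule poly_mapping_eqI) (simp add: lookup_single when_def)
  then show ?thesis
    by (simp add: path_mult_def frag_extend_def frag_cmul_sum)
qed

lemma path_mult_of [simp]: "path_mult (frag_of p) (frag_of q) = frag_of (p @ q)"
  by (simp add: path_mult_eq_frag_extend)

lemma path_mult_diff_left: "path_mult (f - f') g = path_mult f g - path_mult f' g"
  by (simp add: path_mult_eq_frag_extend frag_extend_diff)

lemma path_mult_add_left: "path_mult (f + f') g = path_mult f g + path_mult f' g"
  by (simp add: path_mult_eq_frag_extend frag_extend_add)

lemma path_mult_diff_right: "path_mult f (g - g') = path_mult f g - path_mult f g'"
  using subset_UNIV
  by (induction f rule: frag_induction)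
     (auto simp: path_mult_eq_frag_extend frag_extend_diff)

lemma path_mult_add_right: "path_mult f (g + g') = path_mult f g + path_mult f g'"
  using path_mult_diff_right [of f "g + g'" g'] by (simp add: algebra_simps)

lemma path_mult_zero [simp]: "path_mult 0 g = 0" "path_mult f 0 = 0"
  using path_mult_diff_left [of 0 0 g] path_mult_diff_right [of f 0 0] by simp_all

lemma path_mult_assoc: "path_mult (path_mult f g) h = path_mult f (path_mult g h)"
proof (induction f rule: frag_induction [OF subset_UNIV])
  case (2 p)
  show ?case
  proof (induction g rule: frag_induction [OF subset_UNIV])
    case (2 q)
    show ?case
      by (induction h rule: frag_induction [OF subset_UNIV]) (simp_all add: path_mult_diff_right)
  qed (simp_all add: path_mult_diff_left path_mult_diff_right)
qed (simp_all add: path_mult_diff_left)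

lemma path_mult_Nil [simp]:
  "path_mult (frag_of []) f = f" "path_mult f (frag_of []) = f"
  by (induction f rule: frag_induction [OF subset_UNIV])
     (simp_all add: path_mult_diff_left path_mult_diff_right)

lemma qpath_append: "qpath Q x p y \<Longrightarrow> qpath Q y q z \<Longrightarrow> qpath Q x (p @ q) z"
  by (induction p arbitrary: x) auto

lemma lin_paths_zero [simp]: "0 \<in> lin_paths Q x y"
  and lin_paths_add [simp]: "f \<in> lin_paths Q x y \<Longrightarrow> g \<in> lin_paths Q x y \<Longrightarrow> f + g \<in> lin_paths Q x y"
  and lin_paths_uminus [simp]: "f \<in> lin_paths Q x y \<Longrightarrow> - f \<in> lin_paths Q x y"
  and lin_paths_of [simp]: "qpath Q x p y \<Longrightarrow> frag_of p \<in> lin_paths Q x y"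
  using keys_add [of f g] by (auto simp: lin_paths_def)

lemma lin_paths_mult [simp]:
  assumes "f \<in> lin_paths Q x y" "g \<in> lin_paths Q y z"
  shows "path_mult f g \<in> lin_paths Q x z"
proof -
  have "Poly_Mapping.keys (path_mult f g) \<subseteq>
      (\<Union>p \<in> Poly_Mapping.keys f. \<Union>q \<in> Poly_Mapping.keys g. {p @ q})"
    unfolding path_mult_eq_frag_extend
    by (rule order_trans [OF keys_frag_extend], rule UN_mono, rule order_refl)
       (rule order_trans [OF keys_frag_extend], simp)
  then show ?thesis
    using assms by (force simp: lin_paths_def intro: qpath_append)
qed

lemma rel_ideal_uminus: "rel_ideal Q R x y f \<Longrightarrow> rel_ideal Q R x y (- f)"
  using rel_ideal.diff [OF rel_ideal.zero] by fastforce

lemma rel_ideal_add: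
  "rel_ideal Q R x y f \<Longrightarrow> rel_ideal Q R x y g \<Longrightarrow> rel_ideal Q R x y (f + g)"
  using rel_ideal.diff [OF _ rel_ideal_uminus] by fastforce

lemma equiv_path_eq: "equiv (lin_paths Q x y) (path_eq Q R x y)"
proof (rule equivI)
  show "path_eq Q R x y \<subseteq> lin_paths Q x y \<times> lin_paths Q x y"
    by (auto simp: path_eq_def)
  show "refl_on (lin_paths Q x y) (path_eq Q R x y)"
    by (auto simp: refl_on_def path_eq_def rel_ideal.zero)
  show "sym (path_eq Q R x y)"
    using rel_ideal_uminus by (fastforce simp: sym_def path_eq_def)
  show "trans (path_eq Q R x y)"
    using rel_ideal_add by (fastforce simp: trans_def path_eq_def)
qed

lemma path_class_eq_iff:
  "f \<in> lin_paths Q x y \<Longrightarrow> g \<in> lin_paths Q x y \<Longrightarrow>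
     path_class Q R x y f = path_class Q R x y g \<longleftrightarrow> rel_ideal Q R x y (f - g)"
  unfolding path_class_def eq_equiv_class_iff [OF equiv_path_eq] by (simp add: path_eq_def)

lemma path_class_add:
  assumes "f \<in> lin_paths Q x y" "g \<in> lin_paths Q x y"
  shows "cadd (path_cat Q R) x y (path_class Q R x y f) (path_class Q R x y g) =
    path_class Q R x y (f + g)"
proof -
  have cong: "congruent2 (path_eq Q R x y) (path_eq Q R x y) (\<lambda>f g. path_class Q R x y (f + g))"
    by (rule congruent2I [OF equiv_path_eq equiv_path_eq])
       (auto simp: path_eq_def path_class_eq_iff)
  show ?thesis
    using UN_equiv_class2 [OF equiv_path_eq equiv_path_eq cong assms]
    by (simp add: path_cat_def flip: path_class_def)
qed

lemma path_class_neg: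
  assumes "f \<in> lin_paths Q x y"
  shows "cneg (path_cat Q R) x y (path_class Q R x y f) = path_class Q R x y (- f)"
proof -
  have cong: "congruent (path_eq Q R x y) (\<lambda>f. path_class Q R x y (- f))"
    by (rule congruentI) (auto simp: path_eq_def path_class_eq_iff dest: rel_ideal_uminus)
  show ?thesis
    using UN_equiv_class [OF equiv_path_eq cong assms]
    by (simp add: path_cat_def flip: path_class_def)
qed

text \<open>
  Composition respects classes because \<open>fg - f'g = (f - f')g\<close> and \<open>fg - fg' = f(g - g')\<close> remain in
  the two-sided ideal generated by the relations.
\<close>

lemma path_class_comp:
  assumes "f \<in> lin_paths Q x y" "g \<in> lin_paths Q y z"
  shows "ccomp (path_cat Q R) x y z (path_class Q R x y f) (path_class Q R y z g) =
    path_class Q R x z (path_mult f g)"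
proof -
  have cong: "congruent2 (path_eq Q R x y) (path_eq Q R y z)
    (\<lambda>f g. path_class Q R x z (path_mult f g))"
  proof (rule congruent2I [OF equiv_path_eq equiv_path_eq])
    fix f f' g
    assume "g \<in> lin_paths Q y z" "(f, f') \<in> path_eq Q R x y"
    then show "path_class Q R x z (path_mult f g) = path_class Q R x z (path_mult f' g)"
      using rel_ideal.right [of Q R x y "f - f'" g z]
      by (subst path_class_eq_iff)
         (auto simp: path_eq_def path_mult_diff_left intro: lin_paths_mult)
  next
    fix f g g'
    assume "f \<in> lin_paths Q x y" "(g, g') \<in> path_eq Q R y z"
    then show "path_class Q R x z (path_mult f g) = path_class Q R x z (path_mult f g')"
      using rel_ideal.left [of f Q x y R z "g - g'"]
      by (subst path_class_eq_iff)
         (auto simp: path_eq_def path_mult_diff_right intro: lin_paths_mult)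
  qed
  show ?thesis
    using UN_equiv_class2 [OF equiv_path_eq equiv_path_eq cong assms]
    by (simp add: path_cat_def flip: path_class_def)
qed

lemma path_cat_hom_iff:
  "F \<in> chom (path_cat Q R) x y \<longleftrightarrow> (\<exists>f \<in> lin_paths Q x y. F = path_class Q R x y f)"
  by (auto simp: path_cat_def path_class_def quotient_def)

lemma path_cat_zero: "czero (path_cat Q R) x y = path_class Q R x y 0"
  and path_cat_id: "cid (path_cat Q R) x = path_class Q R x x (frag_of [])"
  and path_cat_obj [simp]: "cobj (path_cat Q R) = nodes Q"
  by (simp_all add: path_cat_def)

theorem preadditive_path_cat: "preadditive_category (path_cat Q R)"
proof -
  have mult [intro!]: "\<exists>h \<in> lin_paths Q x z. path_class Q R x z (path_mult f g) = path_class Q R x z h"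
    if "f \<in> lin_paths Q x y" "g \<in> lin_paths Q y z" for f g x y z
    using lin_paths_mult [OF that] by blast
  show ?thesis
  proof
    show "ccomp (path_cat Q R) x z w (ccomp (path_cat Q R) x y z F G) H =
        ccomp (path_cat Q R) x y w F (ccomp (path_cat Q R) y z w G H)"
      if "F \<in> chom (path_cat Q R) x y" "G \<in> chom (path_cat Q R) y z"
        "H \<in> chom (path_cat Q R) z w" for F x y G z H w
      using that
      by (clarsimp simp: path_cat_hom_iff path_class_comp path_mult_assoc)
  qed (auto simp: path_cat_hom_iff path_cat_zero path_cat_id path_class_add path_class_neg
      path_class_comp path_mult_add_left path_mult_add_right algebra_simps)
qed


section \<open>The additive closure is additive\<close>

definition is_biproduct ::
    "('o, 'm) lincat \<Rightarrow> 'o \<Rightarrow> 'o \<Rightarrow> 'o \<Rightarrow> 'm \<Rightarrow> 'm \<Rightarrow> 'm \<Rightarrow> 'm \<Rightarrow> bool" where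
  "is_biproduct C x y s i1 i2 p1 p2 \<longleftrightarrow>
     s \<in> cobj C \<and> i1 \<in> chom C x s \<and> i2 \<in> chom C y s \<and> p1 \<in> chom C s x \<and> p2 \<in> chom C s y \<and>
     ccomp C x s x i1 p1 = cid C x \<and> ccomp C x s y i1 p2 = czero C x y \<and>
     ccomp C y s x i2 p1 = czero C y x \<and> ccomp C y s y i2 p2 = cid C y \<and>
     cadd C s s (ccomp C s x s p1 i1) (ccomp C s y s p2 i2) = cid C s"

locale additive_category = preadditive_category +
  assumes biproduct_exists:
    "x \<in> cobj C \<Longrightarrow> y \<in> cobj C \<Longrightarrow> \<exists>s i1 i2 p1 p2. is_biproduct C x y s i1 i2 p1 p2"

context preadditive_category
begin

lemma csum_simps [simp]:
  "csum C x y [] = zero x y" "csum C x y (f # fs) = f \<boxplus>\<^bsub>x,y\<^esub> csum C x y fs"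
  by (simp_all add: csum_def)

text \<open>
  The entries of a matrix product are sums along an index range; the facts below are the usual
  manipulations of finite sums. They are stated for sums over \<open>[0..<n]\<close> with hypotheses of the form
  \<open>k < n\<close>, in which shape the entries of matrices supply them.
\<close>

lemma csum_list_closed: "set fs \<subseteq> hom x y \<Longrightarrow> csum C x y fs \<in> hom x y"
  by (induction fs) auto

lemma csum_closed [simp]: "(\<And>k. k < n \<Longrightarrow> f k \<in> hom x y) \<Longrightarrow> csum C x y (map f [0..<n]) \<in> hom x y"
  by (rule csum_list_closed) auto

lemma csum_Suc:
  assumes "\<And>k. k < Suc n \<Longrightarrow> f k \<in> hom x y"
  shows "csum C x y (map f [0..<Suc n]) = csum C x y (map f [0..<n]) \<boxplus>\<^bsub>x,y\<^esub> f n"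
proof -
  have "csum C x y (fs @ [g]) = csum C x y fs \<boxplus>\<^bsub>x,y\<^esub> g"
    if "set fs \<subseteq> hom x y" "g \<in> hom x y" for fs g
    using that by (induction fs) (simp_all add: add_assoc csum_list_closed)
  moreover have "set (map f [0..<n]) \<subseteq> hom x y"
    using assms by auto
  ultimately show ?thesis
    using assms by simp
qed

lemma csum_eq_zero: "(\<And>k. k < n \<Longrightarrow> f k = zero x y) \<Longrightarrow> csum C x y (map f [0..<n]) = zero x y"
  by (induction n) (simp_all add: csum_Suc del: upt_Suc)

lemma csum_eq_single:
  "k < n \<Longrightarrow> f k \<in> hom x y \<Longrightarrow> (\<And>l. l < n \<Longrightarrow> l \<noteq> k \<Longrightarrow> f l = zero x y) \<Longrightarrow>
     csum C x y (map f [0..<n]) = f k"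
proof (induction n)
  case (Suc n)
  have "f l \<in> hom x y" if "l < Suc n" for l
    using Suc.prems that by (cases "l = k") auto
  then have "csum C x y (map f [0..<Suc n]) = csum C x y (map f [0..<n]) \<boxplus>\<^bsub>x,y\<^esub> f n"
    by (rule csum_Suc)
  also have "\<dots> = f k"
  proof (cases "k = n")
    case True
    then have "csum C x y (map f [0..<n]) = zero x y"
      using Suc.prems by (intro csum_eq_zero) simp
    with True Suc.prems show ?thesis
      by simp
  next
    case False
    with Suc show ?thesis
      by simp
  qed
  finally show ?case .
qed simp

lemma csum_cong:
  "(\<And>k. k < n \<Longrightarrow> f k = g k) \<Longrightarrow> csum C x y (map f [0..<n]) = csum C x y (map g [0..<n])"
  by (rule arg_cong [where f = "csum C x y"]) simp

lemma csum_add: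
  "(\<And>k. k < n \<Longrightarrow> f k \<in> hom x y) \<Longrightarrow> (\<And>k. k < n \<Longrightarrow> g k \<in> hom x y) \<Longrightarrow>
     csum C x y (map (\<lambda>k. f k \<boxplus>\<^bsub>x,y\<^esub> g k) [0..<n]) =
     csum C x y (map f [0..<n]) \<boxplus>\<^bsub>x,y\<^esub> csum C x y (map g [0..<n])"
  by (induction n) (simp_all add: csum_Suc add_assoc add_left_comm del: upt_Suc)

lemma comp_csum:
  "f \<in> hom x y \<Longrightarrow> (\<And>k. k < n \<Longrightarrow> g k \<in> hom y z) \<Longrightarrow>
     f \<cdot>\<^bsub>x,y,z\<^esub> csum C y z (map g [0..<n]) = csum C x z (map (\<lambda>k. f \<cdot>\<^bsub>x,y,z\<^esub> g k) [0..<n])"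
  by (induction n) (simp_all add: csum_Suc comp_add del: upt_Suc)

lemma csum_comp:
  "(\<And>k. k < n \<Longrightarrow> f k \<in> hom x y) \<Longrightarrow> g \<in> hom y z \<Longrightarrow>
     csum C x y (map f [0..<n]) \<cdot>\<^bsub>x,y,z\<^esub> g = csum C x z (map (\<lambda>k. f k \<cdot>\<^bsub>x,y,z\<^esub> g) [0..<n])"
  by (induction n) (simp_all add: csum_Suc add_comp del: upt_Suc)

lemma csum_swap:
  "(\<And>k l. k < n \<Longrightarrow> l < m \<Longrightarrow> f k l \<in> hom x y) \<Longrightarrow>
     csum C x y (map (\<lambda>k. csum C x y (map (\<lambda>l. f k l) [0..<m])) [0..<n]) =
     csum C x y (map (\<lambda>l. csum C x y (map (\<lambda>k. f k l) [0..<n])) [0..<m])"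
proof (induction n)
  case 0
  show ?case
    by (simp add: csum_eq_zero)
next
  case (Suc n)
  have "csum C x y (map (\<lambda>l. csum C x y (map (\<lambda>k. f k l) [0..<Suc n])) [0..<m]) =
      csum C x y (map (\<lambda>l. csum C x y (map (\<lambda>k. f k l) [0..<n]) \<boxplus>\<^bsub>x,y\<^esub> f n l) [0..<m])"
    using Suc.prems by (intro csum_cong csum_Suc) simp
  then show ?case
    using Suc by (simp add: csum_Suc csum_add del: upt_Suc)
qed

lemma add_closure_hom_iff:
  "M \<in> chom (add_closure C) xs ys \<longleftrightarrow> M \<in> carrier_mat (length xs) (length ys) \<and>
     (\<forall>i < length xs. \<forall>j < length ys. M $$ (i, j) \<in> hom (xs ! i) (ys ! j))"
  by (simp add: add_closure_def)

lemma add_closure_comp_index: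
  "i < length xs \<Longrightarrow> j < length zs \<Longrightarrow> ccomp (add_closure C) xs ys zs M N $$ (i, j) =
     csum C (xs ! i) (zs ! j) (map (\<lambda>k. M $$ (i, k) \<cdot>\<^bsub>xs ! i,ys ! k,zs ! j\<^esub> N $$ (k, j))
       [0..<length ys])"
  by (simp add: add_closure_def)

lemma add_closure_comp_carrier [simp]:
  "ccomp (add_closure C) xs ys zs M N \<in> carrier_mat (length xs) (length zs)"
  by (simp add: add_closure_def)

lemma add_closure_comp_closed:
  "M \<in> chom (add_closure C) xs ys \<Longrightarrow> N \<in> chom (add_closure C) ys zs \<Longrightarrow>
     ccomp (add_closure C) xs ys zs M N \<in> chom (add_closure C) xs zs"
  by (simp add: add_closure_hom_iff add_closure_comp_index)

lemma add_closure_eqI: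
  assumes "M \<in> carrier_mat (length xs) (length ys)" "N \<in> carrier_mat (length xs) (length ys)"
    and "\<And>i j. i < length xs \<Longrightarrow> j < length ys \<Longrightarrow> M $$ (i, j) = N $$ (i, j)"
  shows "M = N"
  using assms by (intro eq_matI) auto

text \<open>
  The entry at \<open>(i, j)\<close> of either product is the double sum of \<open>M\<^sub>i\<^sub>l N\<^sub>l\<^sub>k P\<^sub>k\<^sub>j\<close>, in the two orders of
  summation.
\<close>

lemma add_closure_comp_assoc:
  assumes M: "M \<in> chom (add_closure C) xs ys" and N: "N \<in> chom (add_closure C) ys zs"
    and P: "P \<in> chom (add_closure C) zs ws"
  shows "ccomp (add_closure C) xs zs ws (ccomp (add_closure C) xs ys zs M N) P =
    ccomp (add_closure C) xs ys ws M (ccomp (add_closure C) ys zs ws N P)"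
proof (rule add_closure_eqI [where xs = xs and ys = ws])
  fix i j assume ij: "i < length xs" "j < length ws"
  let ?x = "xs ! i" and ?w = "ws ! j"
  let ?t = "\<lambda>l k. M $$ (i, l) \<cdot>\<^bsub>?x,ys ! l,?w\<^esub> (N $$ (l, k) \<cdot>\<^bsub>ys ! l,zs ! k,?w\<^esub> P $$ (k, j))"
  have M': "\<And>l. l < length ys \<Longrightarrow> M $$ (i, l) \<in> hom ?x (ys ! l)"
    and N': "\<And>l k. l < length ys \<Longrightarrow> k < length zs \<Longrightarrow> N $$ (l, k) \<in> hom (ys ! l) (zs ! k)"
    and P': "\<And>k. k < length zs \<Longrightarrow> P $$ (k, j) \<in> hom (zs ! k) ?w"
    using M N P ij by (auto simp: add_closure_hom_iff)
  have "ccomp (add_closure C) xs zs ws (ccomp (add_closure C) xs ys zs M N) P $$ (i, j) =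
      csum C ?x ?w (map (\<lambda>k. csum C ?x ?w (map (\<lambda>l. ?t l k) [0..<length ys])) [0..<length zs])"
    unfolding add_closure_comp_index [OF ij]
  proof (rule csum_cong)
    fix k assume k: "k < length zs"
    have "csum C ?x (zs ! k) (map (\<lambda>l. M $$ (i, l) \<cdot>\<^bsub>?x,ys ! l,zs ! k\<^esub> N $$ (l, k)) [0..<length ys])
          \<cdot>\<^bsub>?x,zs ! k,?w\<^esub> P $$ (k, j) =
        csum C ?x ?w (map (\<lambda>l. (M $$ (i, l) \<cdot>\<^bsub>?x,ys ! l,zs ! k\<^esub> N $$ (l, k))
          \<cdot>\<^bsub>?x,zs ! k,?w\<^esub> P $$ (k, j)) [0..<length ys])"
      using k M' N' P' by (intro csum_comp) simp_all
    also have "\<dots> = csum C ?x ?w (map (\<lambda>l. ?t l k) [0..<length ys])"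
      using k M' N' P' by (intro csum_cong comp_assoc) simp_all
    finally show "ccomp (add_closure C) xs ys zs M N $$ (i, k) \<cdot>\<^bsub>?x,zs ! k,?w\<^esub> P $$ (k, j) =
        csum C ?x ?w (map (\<lambda>l. ?t l k) [0..<length ys])"
      using ij k by (simp add: add_closure_comp_index)
  qed
  also have "\<dots> =
      csum C ?x ?w (map (\<lambda>l. csum C ?x ?w (map (\<lambda>k. ?t l k) [0..<length zs])) [0..<length ys])"
    using M' N' P' by (intro csum_swap) simp_all
  also have "\<dots> = ccomp (add_closure C) xs ys ws M (ccomp (add_closure C) ys zs ws N P) $$ (i, j)"
    unfolding add_closure_comp_index [OF ij] using ij M' N' P'
    by (intro csum_cong) (simp add: add_closure_comp_index comp_csum)
  finally show "ccomp (add_closure C) xs zs ws (ccomp (add_closure C) xs ys zs M N) P $$ (i, j) =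
    ccomp (add_closure C) xs ys ws M (ccomp (add_closure C) ys zs ws N P) $$ (i, j)" .
qed simp_all

text \<open>
  Identities of tuples as well as the inclusions and projections of a concatenation are matrices of
  identities and zeros. A common description by the positions \<open>P\<close> of the identities makes one
  computation serve for all their products: a row with an identity in column \<open>k\<close> picks row \<open>k\<close> of
  the second factor.
\<close>

definition select_mat :: "'o list \<Rightarrow> 'o list \<Rightarrow> (nat \<Rightarrow> nat \<Rightarrow> bool) \<Rightarrow> 'm mat" where
  "select_mat xs ys P = mat (length xs) (length ys) (\<lambda>(i, j).
     if P i j then one (xs ! i) else zero (xs ! i) (ys ! j))"

lemma select_mat_carrier [simp]: "select_mat xs ys P \<in> carrier_mat (length xs) (length ys)"
  by (simp add: select_mat_def)

lemma select_mat_closed: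
  assumes "xs \<in> lists (cobj C)"
    and "\<And>i j. i < length xs \<Longrightarrow> j < length ys \<Longrightarrow> P i j \<Longrightarrow> xs ! i = ys ! j"
  shows "select_mat xs ys P \<in> chom (add_closure C) xs ys"
proof -
  have "one (xs ! i) \<in> hom (xs ! i) (ys ! j)" if "i < length xs" "j < length ys" "P i j" for i j
  proof -
    have "xs ! i \<in> cobj C"
      using assms(1) that(1) by (auto simp: in_lists_conv_set)
    then show ?thesis
      using id_closed [of "xs ! i"] assms(2) [OF that] by simp
  qed
  then show ?thesis
    by (simp add: add_closure_hom_iff select_mat_def)
qed

lemma select_mat_comp_index:
  assumes "xs \<in> lists (cobj C)"
    and "\<And>k. k < length ys \<Longrightarrow> P i k \<Longrightarrow> xs ! i = ys ! k \<and> k = k0"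
    and "N \<in> chom (add_closure C) ys zs" "i < length xs" "j < length zs"
  shows "ccomp (add_closure C) xs ys zs (select_mat xs ys P) N $$ (i, j) =
    (if k0 < length ys \<and> P i k0 then N $$ (k0, j) else zero (xs ! i) (zs ! j))"
proof -
  have N: "N $$ (k, j) \<in> hom (ys ! k) (zs ! j)" if "k < length ys" for k
    using assms(3,5) that by (simp add: add_closure_hom_iff)
  have ob: "xs ! i \<in> cobj C"
    using assms(1,4) by (auto simp: in_lists_conv_set)
  let ?f = "\<lambda>k. select_mat xs ys P $$ (i, k) \<cdot>\<^bsub>xs ! i,ys ! k,zs ! j\<^esub> N $$ (k, j)"
  have 0: "?f k = zero (xs ! i) (zs ! j)" if "k < length ys" "\<not> P i k" for k
    using assms(4) that N by (simp add: select_mat_def)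
  have 1: "?f k0 = N $$ (k0, j)" "N $$ (k0, j) \<in> hom (xs ! i) (zs ! j)" if "k0 < length ys" "P i k0"
  proof -
    have "xs ! i = ys ! k0"
      using assms(2) that by blast
    then show "?f k0 = N $$ (k0, j)" "N $$ (k0, j) \<in> hom (xs ! i) (zs ! j)"
      using ob N [OF that(1)] that assms(4) by (simp_all add: select_mat_def)
  qed
  show ?thesis
  proof (cases "k0 < length ys \<and> P i k0")
    case True
    then show ?thesis
      using 1 0 assms(2,4,5)
      by (subst add_closure_comp_index, simp, simp, subst csum_eq_single [where k = k0]) auto
  next
    case False
    then have "?f k = zero (xs ! i) (zs ! j)" if "k < length ys" for k
      using 0 that assms(2) by blast
    with False show ?thesis
      unfolding add_closure_comp_index [OF assms(4,5)] by (simp only: csum_eq_zero if_False)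
  qed
qed

lemma add_closure_id: "cid (add_closure C) xs = select_mat xs xs (=)"
  by (simp add: add_closure_def select_mat_def)

lemma add_closure_comp_id:
  assumes "ys \<in> lists (cobj C)" "M \<in> chom (add_closure C) xs ys"
  shows "ccomp (add_closure C) xs ys ys M (cid (add_closure C) ys) = M"
proof (rule add_closure_eqI [where xs = xs and ys = ys])
  fix i j assume ij: "i < length xs" "j < length ys"
  have "ys ! j \<in> cobj C"
    using assms(1) ij by (auto simp: in_lists_conv_set)
  then show "ccomp (add_closure C) xs ys ys M (cid (add_closure C) ys) $$ (i, j) = M $$ (i, j)"
    using assms(2) ij
    by (subst add_closure_comp_index, simp, simp, subst csum_eq_single [where k = j])
       (auto simp: add_closure_id select_mat_def add_closure_hom_iff)
qed (use assms in \<open>simp_all add: add_closure_hom_iff\<close>)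

lemma preadditive_add_closure: "preadditive_category (add_closure C)"
proof
  fix M N xs ys assume M: "M \<in> chom (add_closure C) xs ys" and N: "N \<in> chom (add_closure C) xs ys"
  then show "cadd (add_closure C) xs ys M N = cadd (add_closure C) xs ys N M"
    by (intro add_closure_eqI [where xs = xs and ys = ys])
       (simp_all add: add_closure_hom_iff, simp_all add: add_closure_def add_comm)
next
  fix M N P xs ys
  assume "M \<in> chom (add_closure C) xs ys" "N \<in> chom (add_closure C) xs ys"
    "P \<in> chom (add_closure C) xs ys"
  then show "cadd (add_closure C) xs ys (cadd (add_closure C) xs ys M N) P =
    cadd (add_closure C) xs ys M (cadd (add_closure C) xs ys N P)"
    by (intro add_closure_eqI [where xs = xs and ys = ys])
       (simp_all add: add_closure_hom_iff, simp_all add: add_closure_def add_assoc)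
next
  fix M xs ys assume "M \<in> chom (add_closure C) xs ys"
  then show "cadd (add_closure C) xs ys (czero (add_closure C) xs ys) M = M"
    "cadd (add_closure C) xs ys (cneg (add_closure C) xs ys M) M = czero (add_closure C) xs ys"
    by (auto intro!: add_closure_eqI [where xs = xs and ys = ys] simp: add_closure_def)
next
  fix M N P xs ys zs
  assume "M \<in> chom (add_closure C) xs ys"
    and "N \<in> chom (add_closure C) ys zs" "P \<in> chom (add_closure C) ys zs"
  then show "ccomp (add_closure C) xs ys zs M (cadd (add_closure C) ys zs N P) =
    cadd (add_closure C) xs zs (ccomp (add_closure C) xs ys zs M N) (ccomp (add_closure C) xs ys zs M P)"
    by (intro add_closure_eqI [where xs = xs and ys = zs])
      (auto simp: add_closure_def comp_add simp flip: csum_add intro!: csum_cong)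
next
  fix M N P xs ys zs
  assume "M \<in> chom (add_closure C) xs ys" "N \<in> chom (add_closure C) xs ys"
    and "P \<in> chom (add_closure C) ys zs"
  then show "ccomp (add_closure C) xs ys zs (cadd (add_closure C) xs ys M N) P =
    cadd (add_closure C) xs zs (ccomp (add_closure C) xs ys zs M P) (ccomp (add_closure C) xs ys zs N P)"
    by (intro add_closure_eqI [where xs = xs and ys = zs])
      (auto simp: add_closure_def add_comp simp flip: csum_add intro!: csum_cong)
next
  fix xs assume "xs \<in> cobj (add_closure C)"
  then have xs: "xs \<in> lists (cobj C)"
    by (simp add: add_closure_def)
  then show "cid (add_closure C) xs \<in> chom (add_closure C) xs xs"
    by (simp add: add_closure_id select_mat_closed)
  fix M ys assume "M \<in> chom (add_closure C) xs ys"
  moreover have "ccomp (add_closure C) xs xs ys (select_mat xs xs (=)) M $$ (i, j) = M $$ (i, j)"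
    if "i < length xs" "j < length ys" for i j
    using xs calculation that by (subst select_mat_comp_index [where ?k0.0 = i]) auto
  ultimately show "ccomp (add_closure C) xs xs ys (cid (add_closure C) xs) M = M"
    by (intro add_closure_eqI [where xs = xs and ys = ys])
       (simp_all add: add_closure_id, simp add: add_closure_hom_iff)
next
  fix M xs ys assume "ys \<in> cobj (add_closure C)" "M \<in> chom (add_closure C) xs ys"
  then show "ccomp (add_closure C) xs ys ys M (cid (add_closure C) ys) = M"
    by (intro add_closure_comp_id) (simp_all add: add_closure_def)
qed (auto simp: add_closure_comp_closed add_closure_comp_assoc, auto simp: add_closure_def)

text \<open>
  The biproduct of two tuples is their concatenation.
\<close>

theorem additive_add_closure: "additive_category (add_closure C)"
proof -
  interpret A: preadditive_category "add_closure C"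
    by (rule preadditive_add_closure)
  show ?thesis
  proof
    fix xs ys assume "xs \<in> cobj (add_closure C)" "ys \<in> cobj (add_closure C)"
    then have ob: "xs \<in> lists (cobj C)" "ys \<in> lists (cobj C)" "xs @ ys \<in> lists (cobj C)"
      by (auto simp: add_closure_def)
    let ?n = "length xs"
    let ?i1 = "select_mat xs (xs @ ys) (=)" and ?i2 = "select_mat ys (xs @ ys) (\<lambda>i j. j = i + ?n)"
    let ?p1 = "select_mat (xs @ ys) xs (=)" and ?p2 = "select_mat (xs @ ys) ys (\<lambda>i j. i = j + ?n)"
    have hom: "?i1 \<in> chom (add_closure C) xs (xs @ ys)" "?i2 \<in> chom (add_closure C) ys (xs @ ys)"
      "?p1 \<in> chom (add_closure C) (xs @ ys) xs" "?p2 \<in> chom (add_closure C) (xs @ ys) ys"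
      using ob by (auto intro!: select_mat_closed simp: nth_append)
    (* A product of two such matrices is again one of them, as soon as each row i of the first
       has its identity, if any, in a known column k i. *)
    have row: "ccomp (add_closure C) us vs ws (select_mat us vs P) (select_mat vs ws R) =
        mat (length us) (length ws) (\<lambda>(i, j). if k i < length vs \<and> P i (k i) \<and> R (k i) j
          then one (us ! i) else zero (us ! i) (ws ! j))"
      if "us \<in> lists (cobj C)" "select_mat vs ws R \<in> chom (add_closure C) vs ws"
        "\<And>i k'. i < length us \<Longrightarrow> k' < length vs \<Longrightarrow> P i k' \<Longrightarrow> us ! i = vs ! k' \<and> k' = k i"
      for us vs ws P R k
    proof (rule add_closure_eqI [where xs = us and ys = ws])
      fix i j assume ij: "i < length us" "j < length ws"
      then have "ccomp (add_closure C) us vs ws (select_mat us vs P) (select_mat vs ws R) $$ (i, j) =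
          (if k i < length vs \<and> P i (k i) then select_mat vs ws R $$ (k i, j)
           else zero (us ! i) (ws ! j))"
        using that by (intro select_mat_comp_index) auto
      then show "ccomp (add_closure C) us vs ws (select_mat us vs P) (select_mat vs ws R) $$ (i, j) =
          mat (length us) (length ws) (\<lambda>(i, j). if k i < length vs \<and> P i (k i) \<and> R (k i) j
            then one (us ! i) else zero (us ! i) (ws ! j)) $$ (i, j)"
        using ij that(3) [of i "k i"] by (auto simp: select_mat_def)
    qed simp_all
    have "ccomp (add_closure C) xs (xs @ ys) xs ?i1 ?p1 = cid (add_closure C) xs"
      by (subst row [where k = "\<lambda>i. i"])
        (use ob hom in \<open>auto simp: nth_append add_closure_def intro!: cong_mat\<close>)
    moreover have "ccomp (add_closure C) xs (xs @ ys) ys ?i1 ?p2 = czero (add_closure C) xs ys"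
      by (subst row [where k = "\<lambda>i. i"])
        (use ob hom in \<open>auto simp: nth_append add_closure_def intro!: cong_mat\<close>)
    moreover have "ccomp (add_closure C) ys (xs @ ys) xs ?i2 ?p1 = czero (add_closure C) ys xs"
      by (subst row [where k = "\<lambda>i. i + ?n"])
        (use ob hom in \<open>auto simp: nth_append add_closure_def intro!: cong_mat\<close>)
    moreover have "ccomp (add_closure C) ys (xs @ ys) ys ?i2 ?p2 = cid (add_closure C) ys"
      by (subst row [where k = "\<lambda>i. i + ?n"])
        (use ob hom in \<open>auto simp: nth_append add_closure_def intro!: cong_mat\<close>)
    moreover have "cadd (add_closure C) (xs @ ys) (xs @ ys)
        (ccomp (add_closure C) (xs @ ys) xs (xs @ ys) ?p1 ?i1)
        (ccomp (add_closure C) (xs @ ys) ys (xs @ ys) ?p2 ?i2) = cid (add_closure C) (xs @ ys)"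
    proof -
      have "one x \<in> hom x x" if "x \<in> set (xs @ ys)" for x
        using that ob by auto
      then have "one ((xs @ ys) ! i) \<in> hom ((xs @ ys) ! i) ((xs @ ys) ! i)" if "i < ?n + length ys" for i
        using that nth_mem [of i "xs @ ys"] by simp
      then show ?thesis
        by (subst row [where k = "\<lambda>i. i"],
          (use ob hom in \<open>auto simp: nth_append\<close>)[3],
          subst row [where k = "\<lambda>i. i - ?n"],
          (use ob hom in \<open>auto simp: nth_append\<close>)[3])
         (auto simp: add_closure_def intro!: cong_mat)
    qed
    ultimately have "is_biproduct (add_closure C) xs ys (xs @ ys) ?i1 ?i2 ?p1 ?p2"
      using ob hom by (simp add: is_biproduct_def) (simp add: add_closure_def)
    then show "\<exists>s i1 i2 p1 p2. is_biproduct (add_closure C) xs ys s i1 i2 p1 p2"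
      by blast
  qed
qed

end


section \<open>Morphisms of the Adelman category\<close>

text \<open>
  The representatives of zero. They form an ideal, so that equality of morphisms becomes membership of
  the difference, and composition is well defined.
\<close>

definition adel_null :: "('o, 'm) lincat \<Rightarrow> ('o, 'm) adob \<Rightarrow> ('o, 'm) adob \<Rightarrow> 'm set" where
  "adel_null A X Y = {n. \<exists>a \<in> chom A (ad_mid X) (ad_r Y). \<exists>b \<in> chom A (ad_c X) (ad_mid Y).
     n = cadd A (ad_mid X) (ad_mid Y)
           (ccomp A (ad_mid X) (ad_r Y) (ad_mid Y) a (ad_rho Y))
           (ccomp A (ad_mid X) (ad_c X) (ad_mid Y) (ad_gam X) b)}"

lemma adel_eq_iff:
  "(f, g) \<in> adel_eq A X Y \<longleftrightarrow> f \<in> adel_rep A X Y \<and> g \<in> adel_rep A X Y \<and>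
     csub A (ad_mid X) (ad_mid Y) f g \<in> adel_null A X Y"
  by (auto simp: adel_eq_def adel_null_def)

lemma adel_objD:
  assumes "X \<in> adel_obj A"
  shows "ad_r X \<in> cobj A" "ad_mid X \<in> cobj A" "ad_c X \<in> cobj A"
    "ad_rho X \<in> chom A (ad_r X) (ad_mid X)" "ad_gam X \<in> chom A (ad_mid X) (ad_c X)"
  using assms by (simp_all add: adel_obj_def)

lemma adel_hom_iff:
  "F \<in> chom (adel A) X Y \<longleftrightarrow> (\<exists>f \<in> adel_rep A X Y. F = adel_class A X Y f)"
  by (auto simp: adel_def adel_class_def quotient_def)

lemma adel_simps [simp]:
  "cobj (adel A) = adel_obj A"
  "czero (adel A) X Y = adel_class A X Y (czero A (ad_mid X) (ad_mid Y))"
  "cid (adel A) X = adel_class A X X (cid A (ad_mid X))"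
  by (simp_all add: adel_def)

context preadditive_category
begin

lemma sub_self [simp]: "f \<in> hom x y \<Longrightarrow> csub C x y f f = zero x y"
  by (simp add: csub_def)

lemma sub_zero [simp]: "f \<in> hom x y \<Longrightarrow> csub C x y f (zero x y) = f"
  by (simp add: csub_def)

lemma neg_sub: "f \<in> hom x y \<Longrightarrow> g \<in> hom x y \<Longrightarrow> neg x y (csub C x y f g) = csub C x y g f"
  by (simp add: csub_def neg_of_add add_comm)

lemma sub_add_sub:
  assumes "f \<in> hom x y" "g \<in> hom x y" "h \<in> hom x y"
  shows "csub C x y f g \<boxplus>\<^bsub>x,y\<^esub> csub C x y g h = csub C x y f h"
  using assms by (simp add: csub_def add_assoc)

lemma comp_sub:
  "f \<in> hom x y \<Longrightarrow> g \<in> hom y z \<Longrightarrow> h \<in> hom y z \<Longrightarrow>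
     f \<cdot>\<^bsub>x,y,z\<^esub> csub C y z g h = csub C x z (f \<cdot>\<^bsub>x,y,z\<^esub> g) (f \<cdot>\<^bsub>x,y,z\<^esub> h)"
  by (simp add: csub_def comp_add)

lemma sub_comp:
  "f \<in> hom x y \<Longrightarrow> g \<in> hom x y \<Longrightarrow> h \<in> hom y z \<Longrightarrow>
     csub C x y f g \<cdot>\<^bsub>x,y,z\<^esub> h = csub C x z (f \<cdot>\<^bsub>x,y,z\<^esub> h) (g \<cdot>\<^bsub>x,y,z\<^esub> h)"
  by (simp add: csub_def add_comp)

lemma adel_repE:
  assumes "f \<in> adel_rep C X Y"
  obtains \<omega> \<psi> where "f \<in> hom (ad_mid X) (ad_mid Y)"
    "\<omega> \<in> hom (ad_r X) (ad_r Y)" "\<psi> \<in> hom (ad_c X) (ad_c Y)"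
    "ad_rho X \<cdot>\<^bsub>ad_r X,ad_mid X,ad_mid Y\<^esub> f = \<omega> \<cdot>\<^bsub>ad_r X,ad_r Y,ad_mid Y\<^esub> ad_rho Y"
    "ad_gam X \<cdot>\<^bsub>ad_mid X,ad_c X,ad_c Y\<^esub> \<psi> = f \<cdot>\<^bsub>ad_mid X,ad_mid Y,ad_c Y\<^esub> ad_gam Y"
  using assms by (auto simp: adel_rep_def)

lemma adel_repI:
  assumes "f \<in> hom (ad_mid X) (ad_mid Y)"
    "\<omega> \<in> hom (ad_r X) (ad_r Y)" "\<psi> \<in> hom (ad_c X) (ad_c Y)"
    "ad_rho X \<cdot>\<^bsub>ad_r X,ad_mid X,ad_mid Y\<^esub> f = \<omega> \<cdot>\<^bsub>ad_r X,ad_r Y,ad_mid Y\<^esub> ad_rho Y"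
    "ad_gam X \<cdot>\<^bsub>ad_mid X,ad_c X,ad_c Y\<^esub> \<psi> = f \<cdot>\<^bsub>ad_mid X,ad_mid Y,ad_c Y\<^esub> ad_gam Y"
  shows "f \<in> adel_rep C X Y"
  using assms by (auto simp: adel_rep_def)

lemma adel_rep_hom: "f \<in> adel_rep C X Y \<Longrightarrow> f \<in> hom (ad_mid X) (ad_mid Y)"
  by (simp add: adel_rep_def)

lemma adel_nullE:
  assumes "n \<in> adel_null C X Y"
  obtains a b where "a \<in> hom (ad_mid X) (ad_r Y)" "b \<in> hom (ad_c X) (ad_mid Y)"
    "n = a \<cdot>\<^bsub>ad_mid X,ad_r Y,ad_mid Y\<^esub> ad_rho Y \<boxplus>\<^bsub>ad_mid X,ad_mid Y\<^esub>
         ad_gam X \<cdot>\<^bsub>ad_mid X,ad_c X,ad_mid Y\<^esub> b"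
  using assms by (auto simp: adel_null_def)

lemma adel_nullI:
  assumes "a \<in> hom (ad_mid X) (ad_r Y)" "b \<in> hom (ad_c X) (ad_mid Y)"
    "n = a \<cdot>\<^bsub>ad_mid X,ad_r Y,ad_mid Y\<^esub> ad_rho Y \<boxplus>\<^bsub>ad_mid X,ad_mid Y\<^esub>
         ad_gam X \<cdot>\<^bsub>ad_mid X,ad_c X,ad_mid Y\<^esub> b"
  shows "n \<in> adel_null C X Y"
  using assms by (auto simp: adel_null_def)

lemma adel_rep_zero [simp]:
  assumes "X \<in> adel_obj C" "Y \<in> adel_obj C"
  shows "zero (ad_mid X) (ad_mid Y) \<in> adel_rep C X Y"
  by (rule adel_repI [where \<omega> = "zero (ad_r X) (ad_r Y)" and \<psi> = "zero (ad_c X) (ad_c Y)"])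
     (use assms [THEN adel_objD(4)] assms [THEN adel_objD(5)] in simp_all)

lemma adel_rep_comp [simp]:
  assumes "X \<in> adel_obj C" "Y \<in> adel_obj C" "Z \<in> adel_obj C"
    and f: "f \<in> adel_rep C X Y" and g: "g \<in> adel_rep C Y Z"
  shows "f \<cdot>\<^bsub>ad_mid X,ad_mid Y,ad_mid Z\<^esub> g \<in> adel_rep C X Z"
proof -
  note ob [simp] = assms(1-3) [THEN adel_objD(4)] assms(1-3) [THEN adel_objD(5)]
  obtain \<omega> \<psi> where f': "f \<in> hom (ad_mid X) (ad_mid Y)"
    "\<omega> \<in> hom (ad_r X) (ad_r Y)" "\<psi> \<in> hom (ad_c X) (ad_c Y)"
    "ad_rho X \<cdot>\<^bsub>ad_r X,ad_mid X,ad_mid Y\<^esub> f = \<omega> \<cdot>\<^bsub>ad_r X,ad_r Y,ad_mid Y\<^esub> ad_rho Y"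
    "ad_gam X \<cdot>\<^bsub>ad_mid X,ad_c X,ad_c Y\<^esub> \<psi> = f \<cdot>\<^bsub>ad_mid X,ad_mid Y,ad_c Y\<^esub> ad_gam Y"
    using f by (rule adel_repE)
  obtain \<omega>' \<psi>' where g': "g \<in> hom (ad_mid Y) (ad_mid Z)"
    "\<omega>' \<in> hom (ad_r Y) (ad_r Z)" "\<psi>' \<in> hom (ad_c Y) (ad_c Z)"
    "ad_rho Y \<cdot>\<^bsub>ad_r Y,ad_mid Y,ad_mid Z\<^esub> g = \<omega>' \<cdot>\<^bsub>ad_r Y,ad_r Z,ad_mid Z\<^esub> ad_rho Z"
    "ad_gam Y \<cdot>\<^bsub>ad_mid Y,ad_c Y,ad_c Z\<^esub> \<psi>' = g \<cdot>\<^bsub>ad_mid Y,ad_mid Z,ad_c Z\<^esub> ad_gam Z"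
    using g by (rule adel_repE)
  show ?thesis
  proof (rule adel_repI [where \<omega> = "\<omega> \<cdot>\<^bsub>ad_r X,ad_r Y,ad_r Z\<^esub> \<omega>'" and \<psi> = "\<psi> \<cdot>\<^bsub>ad_c X,ad_c Y,ad_c Z\<^esub> \<psi>'"])
    have "ad_rho X \<cdot>\<^bsub>ad_r X,ad_mid X,ad_mid Z\<^esub> f \<cdot>\<^bsub>ad_mid X,ad_mid Y,ad_mid Z\<^esub> g =
        (ad_rho X \<cdot>\<^bsub>ad_r X,ad_mid X,ad_mid Y\<^esub> f) \<cdot>\<^bsub>ad_r X,ad_mid Y,ad_mid Z\<^esub> g"
      using f'(1) g'(1) by (simp add: comp_assoc)
    also have "\<dots> = (\<omega> \<cdot>\<^bsub>ad_r X,ad_r Y,ad_r Z\<^esub> \<omega>') \<cdot>\<^bsub>ad_r X,ad_r Z,ad_mid Z\<^esub> ad_rho Z"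
      unfolding f'(4) using f'(2) g'(1,2,4) by (simp add: comp_assoc)
    finally show "ad_rho X \<cdot>\<^bsub>ad_r X,ad_mid X,ad_mid Z\<^esub> f \<cdot>\<^bsub>ad_mid X,ad_mid Y,ad_mid Z\<^esub> g =
        (\<omega> \<cdot>\<^bsub>ad_r X,ad_r Y,ad_r Z\<^esub> \<omega>') \<cdot>\<^bsub>ad_r X,ad_r Z,ad_mid Z\<^esub> ad_rho Z" .
    have "ad_gam X \<cdot>\<^bsub>ad_mid X,ad_c X,ad_c Z\<^esub> \<psi> \<cdot>\<^bsub>ad_c X,ad_c Y,ad_c Z\<^esub> \<psi>' =
        (ad_gam X \<cdot>\<^bsub>ad_mid X,ad_c X,ad_c Y\<^esub> \<psi>) \<cdot>\<^bsub>ad_mid X,ad_c Y,ad_c Z\<^esub> \<psi>'"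
      using f'(3) g'(3) by (simp add: comp_assoc)
    also have "\<dots> = (f \<cdot>\<^bsub>ad_mid X,ad_mid Y,ad_mid Z\<^esub> g) \<cdot>\<^bsub>ad_mid X,ad_mid Z,ad_c Z\<^esub> ad_gam Z"
      unfolding f'(5) using f'(1) g'(1,3,5) by (simp add: comp_assoc)
    finally show "ad_gam X \<cdot>\<^bsub>ad_mid X,ad_c X,ad_c Z\<^esub> \<psi> \<cdot>\<^bsub>ad_c X,ad_c Y,ad_c Z\<^esub> \<psi>' =
        (f \<cdot>\<^bsub>ad_mid X,ad_mid Y,ad_mid Z\<^esub> g) \<cdot>\<^bsub>ad_mid X,ad_mid Z,ad_c Z\<^esub> ad_gam Z" .
  qed (use f' g' in simp_all)
qed

lemma adel_null_zero [simp]: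
  assumes "X \<in> adel_obj C" "Y \<in> adel_obj C"
  shows "zero (ad_mid X) (ad_mid Y) \<in> adel_null C X Y"
  by (rule adel_nullI [where a = "zero (ad_mid X) (ad_r Y)" and b = "zero (ad_c X) (ad_mid Y)"])
     (use assms [THEN adel_objD(4)] assms [THEN adel_objD(5)] in simp_all)

lemma adel_null_add:
  assumes "X \<in> adel_obj C" "Y \<in> adel_obj C"
    and "m \<in> adel_null C X Y" "n \<in> adel_null C X Y"
  shows "m \<boxplus>\<^bsub>ad_mid X,ad_mid Y\<^esub> n \<in> adel_null C X Y"
proof -
  note [simp] = adel_objD(4) [OF assms(2)] adel_objD(5) [OF assms(1)]
  from assms(3) obtain a b where m: "a \<in> hom (ad_mid X) (ad_r Y)" "b \<in> hom (ad_c X) (ad_mid Y)"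
    "m = a \<cdot>\<^bsub>ad_mid X,ad_r Y,ad_mid Y\<^esub> ad_rho Y \<boxplus>\<^bsub>ad_mid X,ad_mid Y\<^esub>
         ad_gam X \<cdot>\<^bsub>ad_mid X,ad_c X,ad_mid Y\<^esub> b"
    by (rule adel_nullE)
  from assms(4) obtain a' b' where n: "a' \<in> hom (ad_mid X) (ad_r Y)" "b' \<in> hom (ad_c X) (ad_mid Y)"
    "n = a' \<cdot>\<^bsub>ad_mid X,ad_r Y,ad_mid Y\<^esub> ad_rho Y \<boxplus>\<^bsub>ad_mid X,ad_mid Y\<^esub>
         ad_gam X \<cdot>\<^bsub>ad_mid X,ad_c X,ad_mid Y\<^esub> b'"
    by (rule adel_nullE)
  show ?thesis
    by (rule adel_nullI [where a = "a \<boxplus>\<^bsub>ad_mid X,ad_r Y\<^esub> a'" and b = "b \<boxplus>\<^bsub>ad_c X,ad_mid Y\<^esub> b'"])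
       (use m n in \<open>simp_all add: add_comp comp_add add_ac\<close>)
qed

lemma adel_null_neg:
  assumes "X \<in> adel_obj C" "Y \<in> adel_obj C" and "n \<in> adel_null C X Y"
  shows "neg (ad_mid X) (ad_mid Y) n \<in> adel_null C X Y"
proof -
  note [simp] = adel_objD(4) [OF assms(2)] adel_objD(5) [OF assms(1)]
  from assms(3) obtain a b where "a \<in> hom (ad_mid X) (ad_r Y)" "b \<in> hom (ad_c X) (ad_mid Y)"
    "n = a \<cdot>\<^bsub>ad_mid X,ad_r Y,ad_mid Y\<^esub> ad_rho Y \<boxplus>\<^bsub>ad_mid X,ad_mid Y\<^esub>
         ad_gam X \<cdot>\<^bsub>ad_mid X,ad_c X,ad_mid Y\<^esub> b"
    by (rule adel_nullE)
  then show ?thesis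
    by (intro adel_nullI [where a = "neg (ad_mid X) (ad_r Y) a" and b = "neg (ad_c X) (ad_mid Y) b"])
       (simp_all add: neg_of_add)
qed

text \<open>
  If \<open>\<omega>\<close> witnesses that \<open>g\<close> is a morphism, then \<open>(a\<rho>\<^sub>y + \<gamma>\<^sub>x b)g = (a\<omega>)\<rho>\<^sub>z + \<gamma>\<^sub>x(bg)\<close>. This is where the
  condition on \<open>\<rho>\<close> in the definition of a morphism enters; the condition on \<open>\<gamma>\<close> serves in the same
  way for composition from the left.
\<close>

lemma adel_null_comp:
  assumes "X \<in> adel_obj C" "Y \<in> adel_obj C" "Z \<in> adel_obj C"
    and "n \<in> adel_null C X Y" and g: "g \<in> adel_rep C Y Z"
  shows "n \<cdot>\<^bsub>ad_mid X,ad_mid Y,ad_mid Z\<^esub> g \<in> adel_null C X Z"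
proof -
  note [simp] = assms(1-3) [THEN adel_objD(4)] assms(1-3) [THEN adel_objD(5)]
  from assms(4) obtain a b where n: "a \<in> hom (ad_mid X) (ad_r Y)" "b \<in> hom (ad_c X) (ad_mid Y)"
    "n = a \<cdot>\<^bsub>ad_mid X,ad_r Y,ad_mid Y\<^esub> ad_rho Y \<boxplus>\<^bsub>ad_mid X,ad_mid Y\<^esub>
         ad_gam X \<cdot>\<^bsub>ad_mid X,ad_c X,ad_mid Y\<^esub> b"
    by (rule adel_nullE)
  obtain \<omega> \<psi> where g': "g \<in> hom (ad_mid Y) (ad_mid Z)" "\<omega> \<in> hom (ad_r Y) (ad_r Z)"
    "ad_rho Y \<cdot>\<^bsub>ad_r Y,ad_mid Y,ad_mid Z\<^esub> g = \<omega> \<cdot>\<^bsub>ad_r Y,ad_r Z,ad_mid Z\<^esub> ad_rho Z"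
    using g by (rule adel_repE)
  show ?thesis
    by (rule adel_nullI [where a = "a \<cdot>\<^bsub>ad_mid X,ad_r Y,ad_r Z\<^esub> \<omega>"
          and b = "b \<cdot>\<^bsub>ad_c X,ad_mid Y,ad_mid Z\<^esub> g"])
       (use n g' in \<open>simp_all add: add_comp comp_assoc\<close>)
qed

lemma adel_comp_null:
  assumes "X \<in> adel_obj C" "Y \<in> adel_obj C" "Z \<in> adel_obj C"
    and f: "f \<in> adel_rep C X Y" and "n \<in> adel_null C Y Z"
  shows "f \<cdot>\<^bsub>ad_mid X,ad_mid Y,ad_mid Z\<^esub> n \<in> adel_null C X Z"
proof -
  note [simp] = assms(1-3) [THEN adel_objD(4)] assms(1-3) [THEN adel_objD(5)]
  from assms(5) obtain a b where n: "a \<in> hom (ad_mid Y) (ad_r Z)" "b \<in> hom (ad_c Y) (ad_mid Z)"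
    "n = a \<cdot>\<^bsub>ad_mid Y,ad_r Z,ad_mid Z\<^esub> ad_rho Z \<boxplus>\<^bsub>ad_mid Y,ad_mid Z\<^esub>
         ad_gam Y \<cdot>\<^bsub>ad_mid Y,ad_c Y,ad_mid Z\<^esub> b"
    by (rule adel_nullE)
  obtain \<omega> \<psi> where f': "f \<in> hom (ad_mid X) (ad_mid Y)" "\<psi> \<in> hom (ad_c X) (ad_c Y)"
    "ad_gam X \<cdot>\<^bsub>ad_mid X,ad_c X,ad_c Y\<^esub> \<psi> = f \<cdot>\<^bsub>ad_mid X,ad_mid Y,ad_c Y\<^esub> ad_gam Y"
    using f by (rule adel_repE)
  have eq: "f \<cdot>\<^bsub>ad_mid X,ad_mid Y,ad_mid Z\<^esub> ad_gam Y \<cdot>\<^bsub>ad_mid Y,ad_c Y,ad_mid Z\<^esub> b =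
      (ad_gam X \<cdot>\<^bsub>ad_mid X,ad_c X,ad_c Y\<^esub> \<psi>) \<cdot>\<^bsub>ad_mid X,ad_c Y,ad_mid Z\<^esub> b"
    unfolding f'(3) using f'(1) n(2) by (simp add: comp_assoc)
  show ?thesis
    by (rule adel_nullI [where a = "f \<cdot>\<^bsub>ad_mid X,ad_mid Y,ad_r Z\<^esub> a"
          and b = "\<psi> \<cdot>\<^bsub>ad_c X,ad_c Y,ad_mid Z\<^esub> b"])
       (use n f'(1,2) in \<open>simp_all add: comp_add eq comp_assoc\<close>)
qed

lemma equiv_adel_eq:
  assumes "X \<in> adel_obj C" "Y \<in> adel_obj C"
  shows "equiv (adel_rep C X Y) (adel_eq C X Y)"
proof (rule equivI)
  show "adel_eq C X Y \<subseteq> adel_rep C X Y \<times> adel_rep C X Y"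
    by (auto simp: adel_eq_iff)
  show "refl_on (adel_rep C X Y) (adel_eq C X Y)"
    using assms by (auto simp: refl_on_def adel_eq_iff adel_rep_hom)
  show "sym (adel_eq C X Y)"
    using adel_null_neg [OF assms] by (force simp: sym_def adel_eq_iff adel_rep_hom neg_sub)
  show "trans (adel_eq C X Y)"
    unfolding trans_def adel_eq_iff
    using adel_null_add [OF assms] sub_add_sub [of _ "ad_mid X" "ad_mid Y"] adel_rep_hom by metis
qed

lemma adel_class_eq_iff:
  assumes "X \<in> adel_obj C" "Y \<in> adel_obj C" "f \<in> adel_rep C X Y" "g \<in> adel_rep C X Y"
  shows "adel_class C X Y f = adel_class C X Y g \<longleftrightarrow>
    csub C (ad_mid X) (ad_mid Y) f g \<in> adel_null C X Y"
  unfolding adel_class_def eq_equiv_class_iff [OF equiv_adel_eq [OF assms(1,2)] assms(3,4)]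
  using assms by (simp add: adel_eq_iff)

lemma adel_class_eq_zero_iff:
  assumes "X \<in> adel_obj C" "Y \<in> adel_obj C" "f \<in> adel_rep C X Y"
  shows "adel_class C X Y f = adel_class C X Y (zero (ad_mid X) (ad_mid Y)) \<longleftrightarrow>
    f \<in> adel_null C X Y"
  using assms by (simp add: adel_class_eq_iff adel_rep_hom)

lemma adel_class_comp [simp]:
  assumes "X \<in> adel_obj C" "Y \<in> adel_obj C" "Z \<in> adel_obj C"
    and "f \<in> adel_rep C X Y" "g \<in> adel_rep C Y Z"
  shows "ccomp (adel C) X Y Z (adel_class C X Y f) (adel_class C Y Z g) =
    adel_class C X Z (f \<cdot>\<^bsub>ad_mid X,ad_mid Y,ad_mid Z\<^esub> g)"
proof -
  note ob = assms(1-3)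
  have cong: "congruent2 (adel_eq C X Y) (adel_eq C Y Z)
    (\<lambda>f g. adel_class C X Z (f \<cdot>\<^bsub>ad_mid X,ad_mid Y,ad_mid Z\<^esub> g))"
  proof (rule congruent2I [OF equiv_adel_eq equiv_adel_eq])
    fix f f' g
    assume "g \<in> adel_rep C Y Z" "(f, f') \<in> adel_eq C X Y"
    then show "adel_class C X Z (f \<cdot>\<^bsub>ad_mid X,ad_mid Y,ad_mid Z\<^esub> g) =
        adel_class C X Z (f' \<cdot>\<^bsub>ad_mid X,ad_mid Y,ad_mid Z\<^esub> g)"
      using ob adel_null_comp [OF ob, of "csub C (ad_mid X) (ad_mid Y) f f'" g]
      by (simp add: adel_eq_iff adel_class_eq_iff adel_rep_hom sub_comp)
  next
    fix f g g'
    assume "f \<in> adel_rep C X Y" "(g, g') \<in> adel_eq C Y Z"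
    then show "adel_class C X Z (f \<cdot>\<^bsub>ad_mid X,ad_mid Y,ad_mid Z\<^esub> g) =
        adel_class C X Z (f \<cdot>\<^bsub>ad_mid X,ad_mid Y,ad_mid Z\<^esub> g')"
      using ob adel_comp_null [OF ob, of f "csub C (ad_mid Y) (ad_mid Z) g g'"]
      by (simp add: adel_eq_iff adel_class_eq_iff adel_rep_hom comp_sub)
  qed (use ob in simp_all)
  show ?thesis
    using UN_equiv_class2 [OF equiv_adel_eq equiv_adel_eq cong assms(4,5)] ob
    by (simp add: adel_def flip: adel_class_def)
qed


section \<open>Cokernels in the Adelman category\<close>

text \<open>
  The universal property in terms of representatives. Uniqueness of the factorization is a statement
  about differences, whence the condition \<open>epi\<close>, in which \<open>d\<close> ranges over all morphisms between the
  middle objects and not only over representatives.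
\<close>

lemma adel_cokernelI:
  assumes X: "X \<in> adel_obj C" and Y: "Y \<in> adel_obj C" and Q: "Q \<in> adel_obj C"
    and \<phi>: "\<phi> \<in> adel_rep C X Y" and p: "p \<in> adel_rep C Y Q"
    and null: "\<phi> \<cdot>\<^bsub>ad_mid X,ad_mid Y,ad_mid Q\<^esub> p \<in> adel_null C X Q"
    and factor: "\<And>T h. T \<in> adel_obj C \<Longrightarrow> h \<in> adel_rep C Y T \<Longrightarrow>
      \<phi> \<cdot>\<^bsub>ad_mid X,ad_mid Y,ad_mid T\<^esub> h \<in> adel_null C X T \<Longrightarrow>
      \<exists>u \<in> adel_rep C Q T. p \<cdot>\<^bsub>ad_mid Y,ad_mid Q,ad_mid T\<^esub> u = h"
    and epi: "\<And>T d. T \<in> adel_obj C \<Longrightarrow> d \<in> hom (ad_mid Q) (ad_mid T) \<Longrightarrow>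
      p \<cdot>\<^bsub>ad_mid Y,ad_mid Q,ad_mid T\<^esub> d \<in> adel_null C Y T \<Longrightarrow> d \<in> adel_null C Q T"
  shows "is_cokernel (adel C) X Y (adel_class C X Y \<phi>) Q (adel_class C Y Q p)"
  unfolding is_cokernel_def
proof (intro conjI ballI impI)
  show "Q \<in> cobj (adel C)" "adel_class C Y Q p \<in> chom (adel C) Y Q"
    using Q p by (auto simp: adel_hom_iff)
  show "ccomp (adel C) X Y Q (adel_class C X Y \<phi>) (adel_class C Y Q p) = czero (adel C) X Q"
    using X Y Q \<phi> p null by (simp add: adel_class_eq_zero_iff)
  fix T H assume "T \<in> cobj (adel C)" and H: "H \<in> chom (adel C) Y T"
    and H0: "ccomp (adel C) X Y T (adel_class C X Y \<phi>) H = czero (adel C) X T"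
  then have T: "T \<in> adel_obj C"
    by simp
  from H obtain h where h: "h \<in> adel_rep C Y T" "H = adel_class C Y T h"
    by (auto simp: adel_hom_iff)
  then have "\<phi> \<cdot>\<^bsub>ad_mid X,ad_mid Y,ad_mid T\<^esub> h \<in> adel_null C X T"
    using H0 X Y T \<phi> by (simp add: adel_class_eq_zero_iff)
  then obtain u where u: "u \<in> adel_rep C Q T" "p \<cdot>\<^bsub>ad_mid Y,ad_mid Q,ad_mid T\<^esub> u = h"
    using factor T h by blast
  show "\<exists>!U. U \<in> chom (adel C) Q T \<and> ccomp (adel C) Y Q T (adel_class C Y Q p) U = H"
  proof (rule ex1I [of _ "adel_class C Q T u"])
    show "adel_class C Q T u \<in> chom (adel C) Q T \<and>
        ccomp (adel C) Y Q T (adel_class C Y Q p) (adel_class C Q T u) = H"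
      using u h Y Q T p by (auto simp: adel_hom_iff)
    fix W assume W: "W \<in> chom (adel C) Q T \<and> ccomp (adel C) Y Q T (adel_class C Y Q p) W = H"
    then obtain w where w: "w \<in> adel_rep C Q T" "W = adel_class C Q T w"
      by (auto simp: adel_hom_iff)
    with W u h Y Q T p have "adel_class C Y T (p \<cdot>\<^bsub>ad_mid Y,ad_mid Q,ad_mid T\<^esub> w) =
        adel_class C Y T (p \<cdot>\<^bsub>ad_mid Y,ad_mid Q,ad_mid T\<^esub> u)"
      by simp
    then have "csub C (ad_mid Y) (ad_mid T) (p \<cdot>\<^bsub>ad_mid Y,ad_mid Q,ad_mid T\<^esub> w)
        (p \<cdot>\<^bsub>ad_mid Y,ad_mid Q,ad_mid T\<^esub> u) \<in> adel_null C Y T"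
      using w(1) u(1) Y Q T p by (simp only: adel_class_eq_iff adel_rep_comp)
    then have "csub C (ad_mid Q) (ad_mid T) w u \<in> adel_null C Q T"
      using w(1) u(1) Y Q T p by (intro epi) (simp_all add: adel_rep_hom comp_sub)
    then show "W = adel_class C Q T u"
      using w u Q T by (simp add: adel_class_eq_iff)
  qed
qed

end


text \<open>
  The condition on \<open>h\<close> under which the class of \<open>h: T \<rightarrow> Y\<close> lies in the image of the class of
  \<open>\<phi>: X \<rightarrow> Y\<close>: up to representatives of zero, \<open>h\<close> is a multiple \<open>a'\<phi>\<close>. The factor \<open>a'\<close> need not itself
  represent a morphism \<open>T \<rightarrow> X\<close>, as only its compatibility with \<open>\<gamma>\<^sub>x\<close> is required.
\<close>

definition in_adel_image ::
    "('o, 'm) lincat \<Rightarrow> ('o, 'm) adob \<Rightarrow> ('o, 'm) adob \<Rightarrow> 'm \<Rightarrow> ('o, 'm) adob \<Rightarrow> 'm \<Rightarrow> bool" where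
  "in_adel_image A X Y \<phi> T h \<longleftrightarrow>
     (\<exists>a \<in> chom A (ad_mid T) (ad_r Y). \<exists>a' \<in> chom A (ad_mid T) (ad_mid X).
      \<exists>b \<in> chom A (ad_c T) (ad_mid Y). \<exists>b' \<in> chom A (ad_c T) (ad_c X).
        h = cadd A (ad_mid T) (ad_mid Y) (ccomp A (ad_mid T) (ad_r Y) (ad_mid Y) a (ad_rho Y))
              (cadd A (ad_mid T) (ad_mid Y) (ccomp A (ad_mid T) (ad_mid X) (ad_mid Y) a' \<phi>)
                (ccomp A (ad_mid T) (ad_c T) (ad_mid Y) (ad_gam T) b)) \<and>
        ccomp A (ad_mid T) (ad_mid X) (ad_c X) a' (ad_gam X) =
          ccomp A (ad_mid T) (ad_c T) (ad_c X) (ad_gam T) b')"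

context preadditive_category
begin

lemma biproduct_hom:
  assumes "is_biproduct C x y s i1 i2 p1 p2"
  shows "s \<in> cobj C" "i1 \<in> hom x s" "i2 \<in> hom y s" "p1 \<in> hom s x" "p2 \<in> hom s y"
  using assms by (simp_all add: is_biproduct_def)

lemma biproduct_comp:
  assumes "is_biproduct C x y s i1 i2 p1 p2" "x \<in> cobj C" "y \<in> cobj C"
  shows "f \<in> hom x z \<Longrightarrow> i1 \<cdot>\<^bsub>x,s,z\<^esub> p1 \<cdot>\<^bsub>s,x,z\<^esub> f = f"
    "g \<in> hom y z \<Longrightarrow> i1 \<cdot>\<^bsub>x,s,z\<^esub> p2 \<cdot>\<^bsub>s,y,z\<^esub> g = zero x z"
    "f \<in> hom x z \<Longrightarrow> i2 \<cdot>\<^bsub>y,s,z\<^esub> p1 \<cdot>\<^bsub>s,x,z\<^esub> f = zero y z"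
    "g \<in> hom y z \<Longrightarrow> i2 \<cdot>\<^bsub>y,s,z\<^esub> p2 \<cdot>\<^bsub>s,y,z\<^esub> g = g"
proof -
  note h = biproduct_hom [OF assms(1)]
  have "i1 \<cdot>\<^bsub>x,s,x\<^esub> p1 = one x" "i1 \<cdot>\<^bsub>x,s,y\<^esub> p2 = zero x y" "i2 \<cdot>\<^bsub>y,s,x\<^esub> p1 = zero y x" "i2 \<cdot>\<^bsub>y,s,y\<^esub> p2 = one y"
    using assms(1) by (simp_all add: is_biproduct_def)
  then show "f \<in> hom x z \<Longrightarrow> i1 \<cdot>\<^bsub>x,s,z\<^esub> p1 \<cdot>\<^bsub>s,x,z\<^esub> f = f"
    "g \<in> hom y z \<Longrightarrow> i1 \<cdot>\<^bsub>x,s,z\<^esub> p2 \<cdot>\<^bsub>s,y,z\<^esub> g = zero x z"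
    "f \<in> hom x z \<Longrightarrow> i2 \<cdot>\<^bsub>y,s,z\<^esub> p1 \<cdot>\<^bsub>s,x,z\<^esub> f = zero y z"
    "g \<in> hom y z \<Longrightarrow> i2 \<cdot>\<^bsub>y,s,z\<^esub> p2 \<cdot>\<^bsub>s,y,z\<^esub> g = g"
    using assms(2,3) comp_assoc [OF h(2,4), of f z] comp_assoc [OF h(2,5), of g z]
      comp_assoc [OF h(3,4), of f z] comp_assoc [OF h(3,5), of g z]
    by simp_all
qed

lemma biproduct_split:
  assumes "is_biproduct C x y s i1 i2 p1 p2" and f: "f \<in> hom s z"
  shows "f = p1 \<cdot>\<^bsub>s,x,z\<^esub> i1 \<cdot>\<^bsub>x,s,z\<^esub> f \<boxplus>\<^bsub>s,z\<^esub> p2 \<cdot>\<^bsub>s,y,z\<^esub> i2 \<cdot>\<^bsub>y,s,z\<^esub> f"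
proof -
  note h = biproduct_hom [OF assms(1)]
  have "p1 \<cdot>\<^bsub>s,x,s\<^esub> i1 \<boxplus>\<^bsub>s,s\<^esub> p2 \<cdot>\<^bsub>s,y,s\<^esub> i2 = one s"
    using assms(1) by (simp add: is_biproduct_def)
  then have "f = (p1 \<cdot>\<^bsub>s,x,s\<^esub> i1 \<boxplus>\<^bsub>s,s\<^esub> p2 \<cdot>\<^bsub>s,y,s\<^esub> i2) \<cdot>\<^bsub>s,s,z\<^esub> f"
    using h f by simp
  then show ?thesis
    using h f by (simp add: add_comp comp_assoc)
qed

text \<open>
  In the cokernel \<open>Q = (r\<^sub>y \<oplus> x \<rightarrow> y \<oplus> c\<^sub>x \<rightarrow> c\<^sub>y \<oplus> c\<^sub>x)\<close> the summand \<open>x\<close> on the left is a new relation,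
  which kills \<open>\<phi>\<close>. It is sent to \<open>(\<phi>, \<gamma>\<^sub>x)\<close> and not to \<open>(\<phi>, 0)\<close>, because a morphism \<open>h\<close> with \<open>\<phi>h\<close> zero
  satisfies only \<open>\<phi>h = a\<rho>\<^sub>t + \<gamma>\<^sub>x b\<close>; the second component of the factorization of \<open>h\<close> through \<open>Q\<close> is
  there to cancel \<open>\<gamma>\<^sub>x b\<close>. The last claim comes from comparing the components of
  \<open>h j\<^sub>1 = a\<rho>\<^sub>Q + \<gamma>\<^sub>t b\<close> in \<open>y \<oplus> c\<^sub>x\<close>.
\<close>

lemma adel_cokernel:
  assumes X_eq: "X = AdOb rx \<rho>x x \<gamma>x cx" and Y_eq: "Y = AdOb ry \<rho>y y \<gamma>y cy"
    and X: "X \<in> adel_obj C" and Y: "Y \<in> adel_obj C"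
    and \<phi>: "\<phi> \<in> adel_rep C X Y"
    and bs: "is_biproduct C ry x s a1 a2 b1 b2"
    and bm: "is_biproduct C y cx m j1 j2 p1 p2"
    and bt: "is_biproduct C cy cx t k1 k2 q1 q2"
  defines "Q \<equiv> AdOb s (b1 \<cdot>\<^bsub>s,ry,m\<^esub> \<rho>y \<cdot>\<^bsub>ry,y,m\<^esub> j1 \<boxplus>\<^bsub>s,m\<^esub>
      b2 \<cdot>\<^bsub>s,x,m\<^esub> (\<phi> \<cdot>\<^bsub>x,y,m\<^esub> j1 \<boxplus>\<^bsub>x,m\<^esub> \<gamma>x \<cdot>\<^bsub>x,cx,m\<^esub> j2))
    m (p1 \<cdot>\<^bsub>m,y,t\<^esub> \<gamma>y \<cdot>\<^bsub>y,cy,t\<^esub> k1 \<boxplus>\<^bsub>m,t\<^esub> p2 \<cdot>\<^bsub>m,cx,t\<^esub> k2) t"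
  shows "Q \<in> adel_obj C" "j1 \<in> adel_rep C Y Q"
    "is_cokernel (adel C) X Y (adel_class C X Y \<phi>) Q (adel_class C Y Q j1)"
    "\<And>T h. T \<in> adel_obj C \<Longrightarrow> h \<in> adel_rep C T Y \<Longrightarrow>
       h \<cdot>\<^bsub>ad_mid T,y,m\<^esub> j1 \<in> adel_null C T Q \<longleftrightarrow>
       in_adel_image C X Y \<phi> T h"
proof -
  note [simp] = adel_objD [OF X, unfolded X_eq adob.sel] adel_objD [OF Y, unfolded Y_eq adob.sel]
    biproduct_hom [OF bs] biproduct_hom [OF bm] biproduct_hom [OF bt]
    biproduct_comp [OF bs] biproduct_comp [OF bm] biproduct_comp [OF bt]
  have [simp]: "ad_r X = rx" "ad_rho X = \<rho>x" "ad_mid X = x" "ad_gam X = \<gamma>x" "ad_c X = cx"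
    "ad_r Y = ry" "ad_rho Y = \<rho>y" "ad_mid Y = y" "ad_gam Y = \<gamma>y" "ad_c Y = cy"
    by (simp_all add: X_eq Y_eq)
  have [simp]: "j1 \<cdot>\<^bsub>y,m,y\<^esub> p1 = one y" "j1 \<cdot>\<^bsub>y,m,cx\<^esub> p2 = zero y cx"
    "j2 \<cdot>\<^bsub>cx,m,y\<^esub> p1 = zero cx y" "j2 \<cdot>\<^bsub>cx,m,cx\<^esub> p2 = one cx"
    using bm by (simp_all add: is_biproduct_def)
  have \<phi>_hom [simp]: "\<phi> \<in> hom x y"
    using adel_rep_hom [OF \<phi>] by simp
  have Q_simps [simp]: "ad_r Q = s" "ad_mid Q = m" "ad_c Q = t"
    "ad_rho Q = b1 \<cdot>\<^bsub>s,ry,m\<^esub> \<rho>y \<cdot>\<^bsub>ry,y,m\<^esub> j1 \<boxplus>\<^bsub>s,m\<^esub>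
      b2 \<cdot>\<^bsub>s,x,m\<^esub> (\<phi> \<cdot>\<^bsub>x,y,m\<^esub> j1 \<boxplus>\<^bsub>x,m\<^esub> \<gamma>x \<cdot>\<^bsub>x,cx,m\<^esub> j2)"
    "ad_gam Q = p1 \<cdot>\<^bsub>m,y,t\<^esub> \<gamma>y \<cdot>\<^bsub>y,cy,t\<^esub> k1 \<boxplus>\<^bsub>m,t\<^esub> p2 \<cdot>\<^bsub>m,cx,t\<^esub> k2"
    by (simp_all add: Q_def)
  show Q: "Q \<in> adel_obj C"
    by (simp add: adel_obj_def)
  show j1: "j1 \<in> adel_rep C Y Q"
    by (rule adel_repI [where \<omega> = a1 and \<psi> = k1]) (simp_all add: comp_add)
  show "is_cokernel (adel C) X Y (adel_class C X Y \<phi>) Q (adel_class C Y Q j1)"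
  proof (rule adel_cokernelI [OF X Y Q \<phi> j1])
    show "\<phi> \<cdot>\<^bsub>ad_mid X,ad_mid Y,ad_mid Q\<^esub> j1 \<in> adel_null C X Q"
      by (rule adel_nullI [where a = a2 and b = "neg cx m j2"]) (simp_all add: comp_add add_assoc)
  next
    fix T h assume T: "T \<in> adel_obj C" and h: "h \<in> adel_rep C Y T"
      and null: "\<phi> \<cdot>\<^bsub>ad_mid X,ad_mid Y,ad_mid T\<^esub> h \<in> adel_null C X T"
    note [simp] = adel_objD [OF T]
    obtain \<omega> \<psi> where h' [simp]: "h \<in> hom y (ad_mid T)" "\<omega> \<in> hom ry (ad_r T)" "\<psi> \<in> hom cy (ad_c T)"
      "\<rho>y \<cdot>\<^bsub>ry,y,ad_mid T\<^esub> h = \<omega> \<cdot>\<^bsub>ry,ad_r T,ad_mid T\<^esub> ad_rho T"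
      "\<gamma>y \<cdot>\<^bsub>y,cy,ad_c T\<^esub> \<psi> = h \<cdot>\<^bsub>y,ad_mid T,ad_c T\<^esub> ad_gam T"
      using adel_repE [OF h] by auto
    obtain a b where ab [simp]: "a \<in> hom x (ad_r T)" "b \<in> hom cx (ad_mid T)"
      "\<phi> \<cdot>\<^bsub>x,y,ad_mid T\<^esub> h = a \<cdot>\<^bsub>x,ad_r T,ad_mid T\<^esub> ad_rho T \<boxplus>\<^bsub>x,ad_mid T\<^esub> \<gamma>x \<cdot>\<^bsub>x,cx,ad_mid T\<^esub> b"
      using adel_nullE [OF null] by auto
    (* The factorization (h, -b): the sign makes the summand x of the relations of Q go to
       phi h - gamma_x b = a rho_t. *)
    let ?u = "p1 \<cdot>\<^bsub>m,y,ad_mid T\<^esub> h \<boxplus>\<^bsub>m,ad_mid T\<^esub> p2 \<cdot>\<^bsub>m,cx,ad_mid T\<^esub> neg cx (ad_mid T) b"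
    have "?u \<in> adel_rep C Q T"
      by (rule adel_repI [where
            \<omega> = "b1 \<cdot>\<^bsub>s,ry,ad_r T\<^esub> \<omega> \<boxplus>\<^bsub>s,ad_r T\<^esub> b2 \<cdot>\<^bsub>s,x,ad_r T\<^esub> a" and
            \<psi> = "q1 \<cdot>\<^bsub>t,cy,ad_c T\<^esub> \<psi> \<boxplus>\<^bsub>t,ad_c T\<^esub>
              q2 \<cdot>\<^bsub>t,cx,ad_c T\<^esub> neg cx (ad_c T) (b \<cdot>\<^bsub>cx,ad_mid T,ad_c T\<^esub> ad_gam T)"])
         (simp_all add: comp_add add_comp comp_assoc add_assoc)
    moreover have "j1 \<cdot>\<^bsub>y,m,ad_mid T\<^esub> ?u = h"
      by (simp add: comp_add)
    ultimately show "\<exists>u \<in> adel_rep C Q T. j1 \<cdot>\<^bsub>ad_mid Y,ad_mid Q,ad_mid T\<^esub> u = h"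
      by auto
  next
    fix T d assume T: "T \<in> adel_obj C" and "d \<in> hom (ad_mid Q) (ad_mid T)"
      and null: "j1 \<cdot>\<^bsub>ad_mid Y,ad_mid Q,ad_mid T\<^esub> d \<in> adel_null C Y T"
    then have d [simp]: "d \<in> hom m (ad_mid T)"
      by simp
    note [simp] = adel_objD [OF T]
    obtain a b where ab [simp]: "a \<in> hom y (ad_r T)" "b \<in> hom cy (ad_mid T)"
      "j1 \<cdot>\<^bsub>y,m,ad_mid T\<^esub> d = a \<cdot>\<^bsub>y,ad_r T,ad_mid T\<^esub> ad_rho T \<boxplus>\<^bsub>y,ad_mid T\<^esub> \<gamma>y \<cdot>\<^bsub>y,cy,ad_mid T\<^esub> b"
      using adel_nullE [OF null] by auto
    show "d \<in> adel_null C Q T"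
    proof (rule adel_nullI [where a = "p1 \<cdot>\<^bsub>m,y,ad_r T\<^esub> a" and
          b = "q1 \<cdot>\<^bsub>t,cy,ad_mid T\<^esub> b \<boxplus>\<^bsub>t,ad_mid T\<^esub> q2 \<cdot>\<^bsub>t,cx,ad_mid T\<^esub> j2 \<cdot>\<^bsub>cx,m,ad_mid T\<^esub> d"])
      show "d = (p1 \<cdot>\<^bsub>m,y,ad_r T\<^esub> a) \<cdot>\<^bsub>ad_mid Q,ad_r T,ad_mid T\<^esub> ad_rho T \<boxplus>\<^bsub>ad_mid Q,ad_mid T\<^esub>
          ad_gam Q \<cdot>\<^bsub>ad_mid Q,ad_c Q,ad_mid T\<^esub>
            (q1 \<cdot>\<^bsub>t,cy,ad_mid T\<^esub> b \<boxplus>\<^bsub>t,ad_mid T\<^esub> q2 \<cdot>\<^bsub>t,cx,ad_mid T\<^esub> j2 \<cdot>\<^bsub>cx,m,ad_mid T\<^esub> d)"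
        (* The component of d on c_x is arbitrary: it factors through gamma_Q, which is the
           identity on that summand. *)
        by (subst biproduct_split [OF bm d]) (simp add: comp_add add_comp comp_assoc add_assoc)
    qed simp_all
  qed
  fix T h assume T: "T \<in> adel_obj C" and "h \<in> adel_rep C T Y"
  then have h [simp]: "h \<in> hom (ad_mid T) y"
    using adel_rep_hom by fastforce
  note [simp] = adel_objD [OF T]
  let ?x = "ad_mid T" and ?c = "ad_c T" and ?\<gamma> = "ad_gam T"
  show "h \<cdot>\<^bsub>?x,y,m\<^esub> j1 \<in> adel_null C T Q \<longleftrightarrow>
    in_adel_image C X Y \<phi> T h"
  proof
    assume "h \<cdot>\<^bsub>?x,y,m\<^esub> j1 \<in> adel_null C T Q"
    then obtain a b where ab [simp]: "a \<in> hom ?x s" "b \<in> hom ?c m"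
      and eq: "h \<cdot>\<^bsub>?x,y,m\<^esub> j1 = a \<cdot>\<^bsub>?x,s,m\<^esub> ad_rho Q \<boxplus>\<^bsub>?x,m\<^esub> ?\<gamma> \<cdot>\<^bsub>?x,?c,m\<^esub> b"
      by (auto elim!: adel_nullE)
    (* The component in y gives the expression for h, the component in c_x the side condition. *)
    from eq have "(h \<cdot>\<^bsub>?x,y,m\<^esub> j1) \<cdot>\<^bsub>?x,m,y\<^esub> p1 =
        (a \<cdot>\<^bsub>?x,s,m\<^esub> ad_rho Q \<boxplus>\<^bsub>?x,m\<^esub> ?\<gamma> \<cdot>\<^bsub>?x,?c,m\<^esub> b) \<cdot>\<^bsub>?x,m,y\<^esub> p1"
      by simp
    then have 1: "h = (a \<cdot>\<^bsub>?x,s,ry\<^esub> b1) \<cdot>\<^bsub>?x,ry,y\<^esub> \<rho>y \<boxplus>\<^bsub>?x,y\<^esub>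
        ((a \<cdot>\<^bsub>?x,s,x\<^esub> b2) \<cdot>\<^bsub>?x,x,y\<^esub> \<phi> \<boxplus>\<^bsub>?x,y\<^esub> ?\<gamma> \<cdot>\<^bsub>?x,?c,y\<^esub> (b \<cdot>\<^bsub>?c,m,y\<^esub> p1))"
      by (simp add: comp_add add_comp comp_assoc add_assoc)
    from eq have "(h \<cdot>\<^bsub>?x,y,m\<^esub> j1) \<cdot>\<^bsub>?x,m,cx\<^esub> p2 =
        (a \<cdot>\<^bsub>?x,s,m\<^esub> ad_rho Q \<boxplus>\<^bsub>?x,m\<^esub> ?\<gamma> \<cdot>\<^bsub>?x,?c,m\<^esub> b) \<cdot>\<^bsub>?x,m,cx\<^esub> p2"
      by simp
    then have "(a \<cdot>\<^bsub>?x,s,x\<^esub> b2) \<cdot>\<^bsub>?x,x,cx\<^esub> \<gamma>x \<boxplus>\<^bsub>?x,cx\<^esub>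
        ?\<gamma> \<cdot>\<^bsub>?x,?c,cx\<^esub> (b \<cdot>\<^bsub>?c,m,cx\<^esub> p2) = zero ?x cx"
      by (simp add: comp_add add_comp comp_assoc add_assoc)
    then have 2: "?\<gamma> \<cdot>\<^bsub>?x,?c,cx\<^esub> (b \<cdot>\<^bsub>?c,m,cx\<^esub> p2) =
        neg ?x cx ((a \<cdot>\<^bsub>?x,s,x\<^esub> b2) \<cdot>\<^bsub>?x,x,cx\<^esub> \<gamma>x)"
      by (intro neg_unique) simp_all
    have 3: "(a \<cdot>\<^bsub>?x,s,x\<^esub> b2) \<cdot>\<^bsub>?x,x,cx\<^esub> \<gamma>x =
        ?\<gamma> \<cdot>\<^bsub>?x,?c,cx\<^esub> neg ?c cx (b \<cdot>\<^bsub>?c,m,cx\<^esub> p2)"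
      by (simp add: 2)
    show "in_adel_image C X Y \<phi> T h"
      unfolding in_adel_image_def \<open>ad_mid X = x\<close> \<open>ad_mid Y = y\<close> \<open>ad_r Y = ry\<close> \<open>ad_rho Y = \<rho>y\<close>
        \<open>ad_c X = cx\<close> \<open>ad_gam X = \<gamma>x\<close>
      by (intro bexI conjI, rule 1, rule 3) simp_all
  next
    assume "in_adel_image C X Y \<phi> T h"
    then obtain a a' b b' where ab [simp]: "a \<in> hom ?x ry" "a' \<in> hom ?x x" "b \<in> hom ?c y" "b' \<in> hom ?c cx"
      and h_eq: "h = a \<cdot>\<^bsub>?x,ry,y\<^esub> \<rho>y \<boxplus>\<^bsub>?x,y\<^esub> (a' \<cdot>\<^bsub>?x,x,y\<^esub> \<phi> \<boxplus>\<^bsub>?x,y\<^esub> ?\<gamma> \<cdot>\<^bsub>?x,?c,y\<^esub> b)"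
      and eq: "a' \<cdot>\<^bsub>?x,x,cx\<^esub> \<gamma>x = ?\<gamma> \<cdot>\<^bsub>?x,?c,cx\<^esub> b'"
      by (auto simp: in_adel_image_def)
    have eq_j2: "a' \<cdot>\<^bsub>?x,x,m\<^esub> \<gamma>x \<cdot>\<^bsub>x,cx,m\<^esub> j2 = ?\<gamma> \<cdot>\<^bsub>?x,?c,m\<^esub> b' \<cdot>\<^bsub>?c,cx,m\<^esub> j2"
      using arg_cong [OF eq, of "\<lambda>f. f \<cdot>\<^bsub>?x,cx,m\<^esub> j2"] by (simp add: comp_assoc)
    (* The relation a' produces an unwanted a' gamma_x in the component c_x of Q, which equals
       gamma_t b' and is cancelled by -b'. *)
    show "h \<cdot>\<^bsub>?x,y,m\<^esub> j1 \<in> adel_null C T Q"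
    proof (rule adel_nullI [where
            a = "a \<cdot>\<^bsub>?x,ry,s\<^esub> a1 \<boxplus>\<^bsub>?x,s\<^esub> a' \<cdot>\<^bsub>?x,x,s\<^esub> a2" and
            b = "neg ?c m (b' \<cdot>\<^bsub>?c,cx,m\<^esub> j2) \<boxplus>\<^bsub>?c,m\<^esub> b \<cdot>\<^bsub>?c,y,m\<^esub> j1"])
      show "h \<cdot>\<^bsub>?x,y,m\<^esub> j1 =
          (a \<cdot>\<^bsub>?x,ry,s\<^esub> a1 \<boxplus>\<^bsub>?x,s\<^esub> a' \<cdot>\<^bsub>?x,x,s\<^esub> a2) \<cdot>\<^bsub>?x,ad_r Q,ad_mid Q\<^esub> ad_rho Q \<boxplus>\<^bsub>?x,ad_mid Q\<^esub>
          ?\<gamma> \<cdot>\<^bsub>?x,?c,ad_mid Q\<^esub> (neg ?c m (b' \<cdot>\<^bsub>?c,cx,m\<^esub> j2) \<boxplus>\<^bsub>?c,m\<^esub> b \<cdot>\<^bsub>?c,y,m\<^esub> j1)"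
        unfolding h_eq by (simp add: comp_add add_comp comp_assoc add_assoc eq_j2)
    qed simp_all
  qed
qed

end


section \<open>Kernels by duality\<close>

definition op_cat :: "('o, 'm) lincat \<Rightarrow> ('o, 'm) lincat" where
  "op_cat C = \<lparr>
     cobj = cobj C,
     chom = (\<lambda>x y. chom C y x),
     ccomp = (\<lambda>x y z f g. ccomp C z y x g f),
     cid = cid C,
     cadd = (\<lambda>x y. cadd C y x),
     cneg = (\<lambda>x y. cneg C y x),
     czero = (\<lambda>x y. czero C y x) \<rparr>"

lemma op_cat_simps [simp]:
  "cobj (op_cat C) = cobj C" "chom (op_cat C) x y = chom C y x"
  "ccomp (op_cat C) x y z f g = ccomp C z y x g f" "cid (op_cat C) x = cid C x"
  "cadd (op_cat C) x y = cadd C y x" "cneg (op_cat C) x y = cneg C y x"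
  "czero (op_cat C) x y = czero C y x" "csub (op_cat C) x y = csub C y x"
  by (simp_all add: op_cat_def csub_def fun_eq_iff)

text \<open>
  The definition of \<open>Adel\<close> is symmetric under reversing all arrows, so \<open>Adel(A\<^sup>o\<^sup>p)\<close> and \<open>Adel(A)\<^sup>o\<^sup>p\<close>
  agree, once objects are read backwards. Hom-sets, composites and zeros agree literally, as sets of
  representatives, which allows the universal property of a cokernel to be read as that of a kernel.
\<close>

fun op_adob :: "('o, 'm) adob \<Rightarrow> ('o, 'm) adob" where
  "op_adob (AdOb r \<rho> x \<gamma> c) = AdOb c \<gamma> x \<rho> r"

lemma op_adob_simps [simp]:
  "ad_r (op_adob X) = ad_c X" "ad_rho (op_adob X) = ad_gam X" "ad_mid (op_adob X) = ad_mid X"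
  "ad_gam (op_adob X) = ad_rho X" "ad_c (op_adob X) = ad_r X" "op_adob (op_adob X) = X"
  by (cases X; simp)+

lemma op_adob_obj [simp]: "op_adob X \<in> adel_obj (op_cat C) \<longleftrightarrow> X \<in> adel_obj C"
  by (auto simp: adel_obj_def)

lemma adel_rep_op [simp]: "adel_rep (op_cat C) (op_adob Y) (op_adob X) = adel_rep C X Y"
  unfolding adel_rep_def op_cat_simps op_adob_simps by (rule Collect_cong) metis

context preadditive_category
begin

lemma preadditive_op: "preadditive_category (op_cat C)"
  by unfold_locales (simp_all add: comp_assoc comp_add add_comp add_ac)

lemma biproduct_op:
  "is_biproduct C x y s i1 i2 p1 p2 \<Longrightarrow> is_biproduct (op_cat C) x y s p1 p2 i1 i2"
  by (simp add: is_biproduct_def)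

lemma adel_null_op:
  assumes "X \<in> adel_obj C" "Y \<in> adel_obj C"
  shows "adel_null (op_cat C) (op_adob Y) (op_adob X) = adel_null C X Y"
  unfolding adel_null_def op_cat_simps op_adob_simps
  using adel_objD(4) [OF assms(2)] adel_objD(5) [OF assms(1)]
  by (intro Collect_cong) (metis add_comm comp_closed)

lemma adel_class_op:
  assumes "X \<in> adel_obj C" "Y \<in> adel_obj C"
  shows "adel_class (op_cat C) (op_adob Y) (op_adob X) f = adel_class C X Y f"
  by (auto simp: adel_class_def adel_eq_iff adel_null_op [OF assms])

lemma adel_hom_op:
  assumes "X \<in> adel_obj C" "Y \<in> adel_obj C"
  shows "chom (adel (op_cat C)) (op_adob Y) (op_adob X) = chom (adel C) X Y"
  by (auto simp: adel_hom_iff adel_class_op [OF assms])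

lemma adel_comp_op:
  assumes "X \<in> adel_obj C" "Y \<in> adel_obj C" "Z \<in> adel_obj C"
    and F: "F \<in> chom (adel C) X Y" and G: "G \<in> chom (adel C) Y Z"
  shows "ccomp (adel (op_cat C)) (op_adob Z) (op_adob Y) (op_adob X) G F = ccomp (adel C) X Y Z F G"
proof -
  interpret O: preadditive_category "op_cat C"
    by (rule preadditive_op)
  obtain f g where fg: "f \<in> adel_rep C X Y" "F = adel_class C X Y f"
    "g \<in> adel_rep C Y Z" "G = adel_class C Y Z g"
    using F G by (auto simp: adel_hom_iff)
  then have "ccomp (adel (op_cat C)) (op_adob Z) (op_adob Y) (op_adob X) G F =
      ccomp (adel (op_cat C)) (op_adob Z) (op_adob Y) (op_adob X)
        (adel_class (op_cat C) (op_adob Z) (op_adob Y) g)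
        (adel_class (op_cat C) (op_adob Y) (op_adob X) f)"
    using assms(1-3) by (simp only: adel_class_op)
  also have "\<dots> = ccomp (adel C) X Y Z F G"
    using fg assms(1-3) by (subst O.adel_class_comp) (simp_all add: adel_class_op)
  finally show ?thesis .
qed

lemma adel_kernel_op:
  assumes X: "X \<in> adel_obj C" and Y: "Y \<in> adel_obj C" and F: "F \<in> chom (adel C) X Y"
    and cok: "is_cokernel (adel (op_cat C)) (op_adob Y) (op_adob X) F (op_adob K) I"
  shows "is_kernel (adel C) X Y F K I"
proof -
  have zero: "czero (adel (op_cat C)) (op_adob B) (op_adob A) = czero (adel C) A B"
    if "A \<in> adel_obj C" "B \<in> adel_obj C" for A B
    using that by (simp add: adel_class_op)
  have K: "K \<in> adel_obj C"
    using cok by (simp add: is_cokernel_def)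
  have I: "I \<in> chom (adel C) K X"
    using cok K X by (simp add: is_cokernel_def adel_hom_op)
  show ?thesis
    unfolding is_kernel_def
  proof (intro conjI ballI impI)
    show "K \<in> cobj (adel C)" "I \<in> chom (adel C) K X"
      using K I by simp_all
    show "ccomp (adel C) K X Y I F = czero (adel C) K Y"
      using cok K X Y I F unfolding is_cokernel_def by (simp only: adel_comp_op zero)
    fix T H assume "T \<in> cobj (adel C)" and H: "H \<in> chom (adel C) T X"
      and H0: "ccomp (adel C) T X Y H F = czero (adel C) T Y"
    then have T: "T \<in> adel_obj C"
      by simp
    have "\<exists>!U. U \<in> chom (adel (op_cat C)) (op_adob K) (op_adob T) \<and>
        ccomp (adel (op_cat C)) (op_adob X) (op_adob K) (op_adob T) I U = H"
    proof (rule cok [unfolded is_cokernel_def, THEN conjunct2, THEN conjunct2, THEN conjunct2,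
          rule_format])
      show "op_adob T \<in> cobj (adel (op_cat C))"
        using T by simp
      show "H \<in> chom (adel (op_cat C)) (op_adob X) (op_adob T)"
        using T X H by (simp only: adel_hom_op)
      show "ccomp (adel (op_cat C)) (op_adob Y) (op_adob X) (op_adob T) F H =
          czero (adel (op_cat C)) (op_adob Y) (op_adob T)"
        using T X Y H F H0 by (simp only: adel_comp_op zero)
    qed
    then show "\<exists>!U. U \<in> chom (adel C) T K \<and> ccomp (adel C) T K X U I = H"
      using T K X I by (simp only: adel_hom_op adel_comp_op cong: conj_cong)
  qed
qed

end

context additive_category
begin

text \<open>
  The only trace of the construction that exactness needs is the description of the morphisms that the
  projection kills.
\<close>

lemma adel_cokernel_exists:
  assumes "X \<in> adel_obj C" "Y \<in> adel_obj C" "\<phi> \<in> adel_rep C X Y"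
  shows "\<exists>Q p. p \<in> adel_rep C Y Q \<and> Q \<in> adel_obj C \<and>
    is_cokernel (adel C) X Y (adel_class C X Y \<phi>) Q (adel_class C Y Q p) \<and>
    (\<forall>T \<in> adel_obj C. \<forall>h \<in> adel_rep C T Y.
       h \<cdot>\<^bsub>ad_mid T,ad_mid Y,ad_mid Q\<^esub> p \<in> adel_null C T Q \<longleftrightarrow>
       in_adel_image C X Y \<phi> T h)"
proof -
  note ob = adel_objD(1-3) [OF assms(1)] adel_objD(1-3) [OF assms(2)]
  obtain s a1 a2 b1 b2 where bs: "is_biproduct C (ad_r Y) (ad_mid X) s a1 a2 b1 b2"
    using biproduct_exists ob by blast
  obtain m j1 j2 p1 p2 where bm: "is_biproduct C (ad_mid Y) (ad_c X) m j1 j2 p1 p2"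
    using biproduct_exists ob by blast
  obtain t k1 k2 q1 q2 where bt: "is_biproduct C (ad_c Y) (ad_c X) t k1 k2 q1 q2"
    using biproduct_exists ob by blast
  note cok = adel_cokernel [OF adob.collapse [symmetric] adob.collapse [symmetric] assms bs bm bt]
  show ?thesis
    by (intro exI conjI ballI, rule cok(2), rule cok(1), rule cok(3)) (simp add: cok(4))
qed

lemma adel_kernel_exists:
  assumes "X \<in> adel_obj C" "Y \<in> adel_obj C" "F \<in> chom (adel C) X Y"
  shows "\<exists>K I. is_kernel (adel C) X Y F K I"
proof -
  interpret O: additive_category "op_cat C"
  proof -
    interpret O: preadditive_category "op_cat C"
      by (rule preadditive_op)
    show "additive_category (op_cat C)"
    proof
      fix x y assume "x \<in> cobj (op_cat C)" "y \<in> cobj (op_cat C)"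
      then obtain s i1 i2 p1 p2 where "is_biproduct C x y s i1 i2 p1 p2"
        using biproduct_exists [of x y] by auto
      then show "\<exists>s i1 i2 p1 p2. is_biproduct (op_cat C) x y s i1 i2 p1 p2"
        by (intro exI) (rule biproduct_op)
    qed
  qed
  obtain \<phi> where \<phi>: "\<phi> \<in> adel_rep C X Y" "F = adel_class C X Y \<phi>"
    using assms(3) by (auto simp: adel_hom_iff)
  obtain Q p where "is_cokernel (adel (op_cat C)) (op_adob Y) (op_adob X)
      (adel_class (op_cat C) (op_adob Y) (op_adob X) \<phi>) Q p"
    using O.adel_cokernel_exists [of "op_adob Y" "op_adob X" \<phi>] assms(1,2) \<phi>(1) by auto
  then have "is_cokernel (adel (op_cat C)) (op_adob Y) (op_adob X) F (op_adob (op_adob Q)) p"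
    using assms \<phi> by (simp add: adel_class_op)
  then show ?thesis
    using adel_kernel_op assms by blast
qed


section \<open>An exactness criterion\<close>

text \<open>
  The image of \<open>{\<phi>}\<close> is the kernel of its cokernel \<open>{p}\<close>, so the claim is that \<open>{p}\<close> and \<open>{g}\<close> kill the
  same morphisms. One direction is the hypothesis \<open>lift\<close>; for the other, \<open>{g}\<close> factors through \<open>{p}\<close>
  since the composite is zero.
\<close>

lemma adel_exactI:
  assumes X: "X \<in> adel_obj C" and Y: "Y \<in> adel_obj C" and Z: "Z \<in> adel_obj C"
    and \<phi>: "\<phi> \<in> adel_rep C X Y" and g: "g \<in> adel_rep C Y Z"
    and null: "\<phi> \<cdot>\<^bsub>ad_mid X,ad_mid Y,ad_mid Z\<^esub> g \<in> adel_null C X Z"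
    and lift: "\<And>T h. T \<in> adel_obj C \<Longrightarrow> h \<in> adel_rep C T Y \<Longrightarrow>
      h \<cdot>\<^bsub>ad_mid T,ad_mid Y,ad_mid Z\<^esub> g \<in> adel_null C T Z \<Longrightarrow>
      in_adel_image C X Y \<phi> T h"
  shows "exact_at (adel C) X Y Z (adel_class C X Y \<phi>) (adel_class C Y Z g)"
proof -
  obtain Q p where p: "p \<in> adel_rep C Y Q" and Q: "Q \<in> adel_obj C"
    and cok: "is_cokernel (adel C) X Y (adel_class C X Y \<phi>) Q (adel_class C Y Q p)"
    and crit: "\<And>T h. T \<in> adel_obj C \<Longrightarrow> h \<in> adel_rep C T Y \<Longrightarrow>
       h \<cdot>\<^bsub>ad_mid T,ad_mid Y,ad_mid Q\<^esub> p \<in> adel_null C T Q \<longleftrightarrow>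
       in_adel_image C X Y \<phi> T h"
    using adel_cokernel_exists [OF X Y \<phi>] by blast
  have G: "adel_class C Y Z g \<in> chom (adel C) Y Z"
    using g by (auto simp: adel_hom_iff)
  have "\<exists>!U. U \<in> chom (adel C) Q Z \<and>
      ccomp (adel C) Y Q Z (adel_class C Y Q p) U = adel_class C Y Z g"
    using cok G X Y Z \<phi> g null by (simp add: is_cokernel_def adel_class_eq_zero_iff)
  then obtain u where u: "u \<in> adel_rep C Q Z"
    and "ccomp (adel C) Y Q Z (adel_class C Y Q p) (adel_class C Q Z u) = adel_class C Y Z g"
    by (auto simp: adel_hom_iff)
  then have g_eq: "adel_class C Y Z g = adel_class C Y Z (p \<cdot>\<^bsub>ad_mid Y,ad_mid Q,ad_mid Z\<^esub> u)"
    using p Q Y Z by simp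
  have same_null: "ccomp (adel C) T Y Q H (adel_class C Y Q p) = czero (adel C) T Q \<longleftrightarrow>
      ccomp (adel C) T Y Z H (adel_class C Y Z g) = czero (adel C) T Z"
    if T: "T \<in> adel_obj C" and H: "H \<in> chom (adel C) T Y" for T H
  proof -
    obtain h where h: "h \<in> adel_rep C T Y" "H = adel_class C T Y h"
      using H by (auto simp: adel_hom_iff)
    have 1: "ccomp (adel C) T Y Q H (adel_class C Y Q p) = czero (adel C) T Q \<longleftrightarrow>
        h \<cdot>\<^bsub>ad_mid T,ad_mid Y,ad_mid Q\<^esub> p \<in> adel_null C T Q"
      using h p T Y Q by (simp add: adel_class_eq_zero_iff)
    have 2: "ccomp (adel C) T Y Z H (adel_class C Y Z g) = czero (adel C) T Z \<longleftrightarrow>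
        h \<cdot>\<^bsub>ad_mid T,ad_mid Y,ad_mid Z\<^esub> g \<in> adel_null C T Z"
      using h g T Y Z by (simp add: adel_class_eq_zero_iff)
    have 3: "h \<cdot>\<^bsub>ad_mid T,ad_mid Y,ad_mid Z\<^esub> p \<cdot>\<^bsub>ad_mid Y,ad_mid Q,ad_mid Z\<^esub> u \<in> adel_null C T Z"
      if "h \<cdot>\<^bsub>ad_mid T,ad_mid Y,ad_mid Q\<^esub> p \<in> adel_null C T Q"
      using adel_null_comp [OF T Q Z that u] adel_rep_hom [OF h(1)] adel_rep_hom [OF p]
        adel_rep_hom [OF u] by (simp add: comp_assoc)
    have 4: "ccomp (adel C) T Y Z H (adel_class C Y Z g) = czero (adel C) T Z"
      if "h \<cdot>\<^bsub>ad_mid T,ad_mid Y,ad_mid Q\<^esub> p \<in> adel_null C T Q"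
      using 3 [OF that] unfolding g_eq using h p u T Y Q Z by (simp add: adel_class_eq_zero_iff)
    show ?thesis
      using 1 2 4 crit [OF T h(1)] lift [OF T h(1)] by blast
  qed
  obtain K I where ker: "is_kernel (adel C) Y Q (adel_class C Y Q p) K I"
    using adel_kernel_exists [OF Y Q, of "adel_class C Y Q p"] p by (auto simp: adel_hom_iff)
  have "is_kernel (adel C) Y Z (adel_class C Y Z g) K I"
    unfolding is_kernel_def
  proof (intro conjI ballI impI)
    show K: "K \<in> cobj (adel C)" and I: "I \<in> chom (adel C) K Y"
      using ker by (simp_all add: is_kernel_def)
    then show "ccomp (adel C) K Y Z I (adel_class C Y Z g) = czero (adel C) K Z"
      using ker same_null [of K I] by (simp add: is_kernel_def)
    fix T H assume "T \<in> cobj (adel C)" "H \<in> chom (adel C) T Y"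
      "ccomp (adel C) T Y Z H (adel_class C Y Z g) = czero (adel C) T Z"
    then show "\<exists>!u. u \<in> chom (adel C) T K \<and> ccomp (adel C) T K Y u I = H"
      using ker same_null [of T H] by (simp add: is_kernel_def)
  qed
  then show ?thesis
    using cok ker unfolding exact_at_def is_image_def by blast
qed

end


section \<open>The kernel-cokernel sequence of a morphism and the snake sequence\<close>

context preadditive_category
begin

lemma in_adel_imageI:
  assumes "a \<in> hom (ad_mid T) (ad_r Y)" "a' \<in> hom (ad_mid T) (ad_mid X)"
    "b \<in> hom (ad_c T) (ad_mid Y)" "b' \<in> hom (ad_c T) (ad_c X)"
    "h = a \<cdot>\<^bsub>ad_mid T,ad_r Y,ad_mid Y\<^esub> ad_rho Y \<boxplus>\<^bsub>ad_mid T,ad_mid Y\<^esub>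
      (a' \<cdot>\<^bsub>ad_mid T,ad_mid X,ad_mid Y\<^esub> \<phi> \<boxplus>\<^bsub>ad_mid T,ad_mid Y\<^esub>
       ad_gam T \<cdot>\<^bsub>ad_mid T,ad_c T,ad_mid Y\<^esub> b)"
    "a' \<cdot>\<^bsub>ad_mid T,ad_mid X,ad_c X\<^esub> ad_gam X = ad_gam T \<cdot>\<^bsub>ad_mid T,ad_c T,ad_c X\<^esub> b'"
  shows "in_adel_image C X Y \<phi> T h"
  using assms unfolding in_adel_image_def by blast

lemma sub_eq_of_eq_add:
  assumes "f \<in> hom x y" "g \<in> hom x y" "h = f \<boxplus>\<^bsub>x,y\<^esub> g"
  shows "h \<boxplus>\<^bsub>x,y\<^esub> neg x y f = g" "h \<boxplus>\<^bsub>x,y\<^esub> neg x y g = f"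
  using assms by (simp_all add: add_assoc add_comm [of f x y g] add_comm [of f x y "neg x y g"]
      add_comm [of g x y "neg x y f"])

end

context additive_category
begin

text \<open>
  The exact sequence of \<open>g\<close> as a morphism \<open>(r \<rightarrow> y \<rightarrow> 0) \<rightarrow> (0 \<rightarrow> z \<rightarrow> c)\<close>, with kernel \<open>K\<close> and cokernel
  \<open>Q\<close>; the two equations say that \<open>g\<close> is such a morphism. The object \<open>e\<close> stands for zero: a zero
  morphism from or to it contributes nothing to the representatives of zero. In each of the four
  places the equation that \<open>h\<close> satisfies already is the expression needed.
\<close>

lemma kernel_cokernel_sequence:
  fixes r \<rho> y g z \<gamma> c e
  assumes ob [simp]: "r \<in> cobj C" "y \<in> cobj C" "z \<in> cobj C" "c \<in> cobj C" "e \<in> cobj C"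
    and mor [simp]: "\<rho> \<in> hom r y" "g \<in> hom y z" "\<gamma> \<in> hom z c"
    and null [simp]: "\<rho> \<cdot>\<^bsub>r,y,z\<^esub> g = zero r z" "g \<cdot>\<^bsub>y,z,c\<^esub> \<gamma> = zero y c"
  defines "N \<equiv> AdOb e (zero e e) e (zero e e) e" and "K \<equiv> AdOb r \<rho> y g z"
    and "U \<equiv> AdOb r \<rho> y (zero y e) e" and "L \<equiv> AdOb e (zero e z) z \<gamma> c"
    and "Q \<equiv> AdOb y g z \<gamma> c"
  shows "one y \<in> adel_rep C K U" "g \<in> adel_rep C U L" "one z \<in> adel_rep C L Q"
    "exact_at (adel C) N K U (adel_class C N K (zero e y)) (adel_class C K U (one y))"
    "exact_at (adel C) K U L (adel_class C K U (one y)) (adel_class C U L g)"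
    "exact_at (adel C) U L Q (adel_class C U L g) (adel_class C L Q (one z))"
    "exact_at (adel C) L Q N (adel_class C L Q (one z)) (adel_class C Q N (zero z e))"
proof -
  have [simp]: "ad_r N = e" "ad_rho N = zero e e" "ad_mid N = e" "ad_gam N = zero e e" "ad_c N = e"
    "ad_r K = r" "ad_rho K = \<rho>" "ad_mid K = y" "ad_gam K = g" "ad_c K = z"
    "ad_r U = r" "ad_rho U = \<rho>" "ad_mid U = y" "ad_gam U = zero y e" "ad_c U = e"
    "ad_r L = e" "ad_rho L = zero e z" "ad_mid L = z" "ad_gam L = \<gamma>" "ad_c L = c"
    "ad_r Q = y" "ad_rho Q = g" "ad_mid Q = z" "ad_gam Q = \<gamma>" "ad_c Q = c"
    by (simp_all add: N_def K_def U_def L_def Q_def)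
  have adobj [simp]: "N \<in> adel_obj C" "K \<in> adel_obj C" "U \<in> adel_obj C" "L \<in> adel_obj C"
    "Q \<in> adel_obj C"
    by (simp_all add: adel_obj_def)
  show KU [simp]: "one y \<in> adel_rep C K U"
    by (rule adel_repI [where \<omega> = "one r" and \<psi> = "zero z e"]) simp_all
  show UL [simp]: "g \<in> adel_rep C U L"
    by (rule adel_repI [where \<omega> = "zero r e" and \<psi> = "zero e c"]) simp_all
  show LQ [simp]: "one z \<in> adel_rep C L Q"
    by (rule adel_repI [where \<omega> = "zero e y" and \<psi> = "one c"]) simp_all
  have NK [simp]: "zero e y \<in> adel_rep C N K" and QN [simp]: "zero z e \<in> adel_rep C Q N"
    using adel_rep_zero [of N K] adel_rep_zero [of Q N] by simp_all
  show "exact_at (adel C) N K U (adel_class C N K (zero e y)) (adel_class C K U (one y))"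
  proof (rule adel_exactI)
    show "zero e y \<cdot>\<^bsub>ad_mid N,ad_mid K,ad_mid U\<^esub> one y \<in> adel_null C N U"
      using adel_null_zero [of N U] by simp
    fix T h assume T: "T \<in> adel_obj C" and h: "h \<in> adel_rep C T K"
      and null: "h \<cdot>\<^bsub>ad_mid T,ad_mid K,ad_mid U\<^esub> one y \<in> adel_null C T U"
    note [simp] = adel_objD [OF T] adel_rep_hom [OF h, simplified]
    obtain s u where "s \<in> hom (ad_mid T) r" "u \<in> hom (ad_c T) y"
      "h = s \<cdot>\<^bsub>ad_mid T,r,y\<^esub> \<rho> \<boxplus>\<^bsub>ad_mid T,y\<^esub> ad_gam T \<cdot>\<^bsub>ad_mid T,ad_c T,y\<^esub> u"
      using adel_nullE [OF null] by auto
    then show "in_adel_image C N K (zero e y) T h"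
      by (intro in_adel_imageI [where a = s and a' = "zero (ad_mid T) e" and b = u
            and b' = "zero (ad_c T) e"]) simp_all
  qed simp_all
  show "exact_at (adel C) K U L (adel_class C K U (one y)) (adel_class C U L g)"
  proof (rule adel_exactI)
    show "one y \<cdot>\<^bsub>ad_mid K,ad_mid U,ad_mid L\<^esub> g \<in> adel_null C K L"
      by (rule adel_nullI [where a = "zero y e" and b = "one z"]) simp_all
    fix T h assume T: "T \<in> adel_obj C" and h: "h \<in> adel_rep C T U"
      and null: "h \<cdot>\<^bsub>ad_mid T,ad_mid U,ad_mid L\<^esub> g \<in> adel_null C T L"
    note [simp] = adel_objD [OF T] adel_rep_hom [OF h, simplified]
    obtain s u where "s \<in> hom (ad_mid T) e" "u \<in> hom (ad_c T) z"
      "h \<cdot>\<^bsub>ad_mid T,y,z\<^esub> g = ad_gam T \<cdot>\<^bsub>ad_mid T,ad_c T,z\<^esub> u"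
      using adel_nullE [OF null] by auto
    (* From h g = gamma_t u: the factor h itself, with gamma_K = g. *)
    then show "in_adel_image C K U (one y) T h"
      by (intro in_adel_imageI [where a = "zero (ad_mid T) r" and a' = h and b = "zero (ad_c T) y"
            and b' = u]) simp_all
  qed simp_all
  show "exact_at (adel C) U L Q (adel_class C U L g) (adel_class C L Q (one z))"
  proof (rule adel_exactI)
    show "g \<cdot>\<^bsub>ad_mid U,ad_mid L,ad_mid Q\<^esub> one z \<in> adel_null C U Q"
      by (rule adel_nullI [where a = "one y" and b = "zero e z"]) simp_all
    fix T h assume T: "T \<in> adel_obj C" and h: "h \<in> adel_rep C T L"
      and null: "h \<cdot>\<^bsub>ad_mid T,ad_mid L,ad_mid Q\<^esub> one z \<in> adel_null C T Q"
    note [simp] = adel_objD [OF T] adel_rep_hom [OF h, simplified]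
    obtain s u where "s \<in> hom (ad_mid T) y" "u \<in> hom (ad_c T) z"
      "h = s \<cdot>\<^bsub>ad_mid T,y,z\<^esub> g \<boxplus>\<^bsub>ad_mid T,z\<^esub> ad_gam T \<cdot>\<^bsub>ad_mid T,ad_c T,z\<^esub> u"
      using adel_nullE [OF null] by auto
    then show "in_adel_image C U L g T h"
      by (intro in_adel_imageI [where a = "zero (ad_mid T) e" and a' = s and b = u
            and b' = "zero (ad_c T) e"]) simp_all
  qed simp_all
  show "exact_at (adel C) L Q N (adel_class C L Q (one z)) (adel_class C Q N (zero z e))"
  proof (rule adel_exactI)
    show "one z \<cdot>\<^bsub>ad_mid L,ad_mid Q,ad_mid N\<^esub> zero z e \<in> adel_null C L N"
      using adel_null_zero [of L N] by simp
    fix T h assume T: "T \<in> adel_obj C" and h: "h \<in> adel_rep C T Q"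
    note [simp] = adel_objD [OF T] adel_rep_hom [OF h, simplified]
    obtain \<psi> where "\<psi> \<in> hom (ad_c T) c"
      "ad_gam T \<cdot>\<^bsub>ad_mid T,ad_c T,c\<^esub> \<psi> = h \<cdot>\<^bsub>ad_mid T,z,c\<^esub> \<gamma>"
      using adel_repE [OF h] by auto
    (* Every morphism T -> Q is hit: the witness psi for gamma provides the side condition, although
       h itself need not be a morphism T -> L. *)
    then show "in_adel_image C L Q (one z) T h"
      by (intro in_adel_imageI [where a = "zero (ad_mid T) y" and a' = h and b = "zero (ad_c T) z"
            and b' = \<psi>]) simp_all
  qed simp_all
qed

end

text \<open>
  The objects of the snake sequence for a chain of three morphisms in an additive category. As in the
  sequence above, \<open>e\<close> stands for zero.
\<close>

locale snake_chain = additive_category C for C :: "('o, 'm) lincat" +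
  fixes e a b c d :: 'o and \<alpha> \<beta> \<gamma> :: 'm
  assumes ob [simp]: "e \<in> cobj C" "a \<in> cobj C" "b \<in> cobj C" "c \<in> cobj C" "d \<in> cobj C"
    and mor [simp]: "\<alpha> \<in> hom a b" "\<beta> \<in> hom b c" "\<gamma> \<in> hom c d"
begin

abbreviation "Ker1 \<equiv> AdOb e (zero e a) a (\<alpha> \<cdot>\<^bsub>a,b,c\<^esub> \<beta>) c"
abbreviation "Ker2 \<equiv> AdOb e (zero e b) b \<beta> c"
abbreviation "Ker3 \<equiv> AdOb a \<alpha> b (\<beta> \<cdot>\<^bsub>b,c,d\<^esub> \<gamma>) d"
abbreviation "Cok1 \<equiv> AdOb a (\<alpha> \<cdot>\<^bsub>a,b,c\<^esub> \<beta>) c \<gamma> d"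
abbreviation "Cok2 \<equiv> AdOb b \<beta> c (zero c e) e"
abbreviation "Cok3 \<equiv> AdOb b (\<beta> \<cdot>\<^bsub>b,c,d\<^esub> \<gamma>) d (zero d e) e"

lemma snake_objects [simp]:
  "Ker1 \<in> adel_obj C" "Ker2 \<in> adel_obj C" "Ker3 \<in> adel_obj C"
  "Cok1 \<in> adel_obj C" "Cok2 \<in> adel_obj C" "Cok3 \<in> adel_obj C"
  by (simp_all add: adel_obj_def)

lemma snake_reps [simp]:
  "\<alpha> \<in> adel_rep C Ker1 Ker2" "one b \<in> adel_rep C Ker2 Ker3" "\<beta> \<in> adel_rep C Ker3 Cok1"
  "one c \<in> adel_rep C Cok1 Cok2" "\<gamma> \<in> adel_rep C Cok2 Cok3"
proof -
  show "\<alpha> \<in> adel_rep C Ker1 Ker2"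
    by (rule adel_repI [where \<omega> = "zero e e" and \<psi> = "one c"]) simp_all
  show "one b \<in> adel_rep C Ker2 Ker3"
    by (rule adel_repI [where \<omega> = "zero e a" and \<psi> = \<gamma>]) simp_all
  show "\<beta> \<in> adel_rep C Ker3 Cok1"
    by (rule adel_repI [where \<omega> = "one a" and \<psi> = "one d"]) simp_all
  show "one c \<in> adel_rep C Cok1 Cok2"
    by (rule adel_repI [where \<omega> = \<alpha> and \<psi> = "zero d e"]) simp_all
  show "\<gamma> \<in> adel_rep C Cok2 Cok3"
    by (rule adel_repI [where \<omega> = "one b" and \<psi> = "zero e e"]) simp_all
qed

text \<open>
  If \<open>h = s\<alpha> + \<gamma>\<^sub>t u\<close>, then \<open>s\<close> is a suitable factor: since \<open>h\<close> is a morphism, \<open>h\<beta> = \<gamma>\<^sub>t \<psi>\<close>, and therefore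
  \<open>s\<alpha>\<beta> = (h - \<gamma>\<^sub>t u)\<beta> = \<gamma>\<^sub>t(\<psi> - u\<beta>)\<close>.
\<close>

lemma snake_exact_Ker2:
  "exact_at (adel C) Ker1 Ker2 Ker3 (adel_class C Ker1 Ker2 \<alpha>) (adel_class C Ker2 Ker3 (one b))"
proof (rule adel_exactI)
  show "\<alpha> \<cdot>\<^bsub>ad_mid Ker1,ad_mid Ker2,ad_mid Ker3\<^esub> one b \<in> adel_null C Ker1 Ker3"
    by (rule adel_nullI [where a = "one a" and b = "zero c b"]) simp_all
  fix T h assume T: "T \<in> adel_obj C" and h: "h \<in> adel_rep C T Ker2"
    and null: "h \<cdot>\<^bsub>ad_mid T,ad_mid Ker2,ad_mid Ker3\<^esub> one b \<in> adel_null C T Ker3"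
  let ?t = "ad_mid T" and ?c = "ad_c T" and ?\<gamma> = "ad_gam T"
  note [simp] = adel_objD [OF T] adel_rep_hom [OF h, simplified]
  obtain s u where [simp]: "s \<in> hom ?t a" "u \<in> hom ?c b"
    and h_eq: "h = s \<cdot>\<^bsub>?t,a,b\<^esub> \<alpha> \<boxplus>\<^bsub>?t,b\<^esub> ?\<gamma> \<cdot>\<^bsub>?t,?c,b\<^esub> u"
    using adel_nullE [OF null] by auto
  obtain \<psi> where [simp]: "\<psi> \<in> hom ?c c" and \<psi>: "?\<gamma> \<cdot>\<^bsub>?t,?c,c\<^esub> \<psi> = h \<cdot>\<^bsub>?t,b,c\<^esub> \<beta>"
    using adel_repE [OF h] by auto
  have "?\<gamma> \<cdot>\<^bsub>?t,?c,c\<^esub> \<psi> = s \<cdot>\<^bsub>?t,a,c\<^esub> \<alpha> \<cdot>\<^bsub>a,b,c\<^esub> \<beta> \<boxplus>\<^bsub>?t,c\<^esub> ?\<gamma> \<cdot>\<^bsub>?t,?c,c\<^esub> u \<cdot>\<^bsub>?c,b,c\<^esub> \<beta>"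
    unfolding \<psi> h_eq by (simp add: add_comp comp_assoc)
  then have "s \<cdot>\<^bsub>?t,a,c\<^esub> \<alpha> \<cdot>\<^bsub>a,b,c\<^esub> \<beta> =
      ?\<gamma> \<cdot>\<^bsub>?t,?c,c\<^esub> (\<psi> \<boxplus>\<^bsub>?c,c\<^esub> neg ?c c (u \<cdot>\<^bsub>?c,b,c\<^esub> \<beta>))"
    using sub_eq_of_eq_add(2) [of "s \<cdot>\<^bsub>?t,a,c\<^esub> \<alpha> \<cdot>\<^bsub>a,b,c\<^esub> \<beta>" ?t c "?\<gamma> \<cdot>\<^bsub>?t,?c,c\<^esub> u \<cdot>\<^bsub>?c,b,c\<^esub> \<beta>"]
    by (simp add: comp_add)
  then show "in_adel_image C Ker1 Ker2 \<alpha> T h"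
    by (intro in_adel_imageI [where a = "zero ?t e" and a' = s and b = u
          and b' = "\<psi> \<boxplus>\<^bsub>?c,c\<^esub> neg ?c c (u \<cdot>\<^bsub>?c,b,c\<^esub> \<beta>)"]) (simp_all add: h_eq)
qed simp_all

text \<open>
  If \<open>h\<beta> = s\<alpha>\<beta> + \<gamma>\<^sub>t u\<close>, then \<open>k = h - s\<alpha>\<close> satisfies \<open>k\<beta> = \<gamma>\<^sub>t u\<close>, and \<open>s\<alpha>\<close> is zero in
  \<open>(a \<rightarrow> b \<rightarrow> d)\<close>.
\<close>

lemma snake_exact_Ker3:
  "exact_at (adel C) Ker2 Ker3 Cok1 (adel_class C Ker2 Ker3 (one b)) (adel_class C Ker3 Cok1 \<beta>)"
proof (rule adel_exactI)
  show "one b \<cdot>\<^bsub>ad_mid Ker2,ad_mid Ker3,ad_mid Cok1\<^esub> \<beta> \<in> adel_null C Ker2 Cok1"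
    by (rule adel_nullI [where a = "zero b a" and b = "one c"]) simp_all
  fix T h assume T: "T \<in> adel_obj C" and h: "h \<in> adel_rep C T Ker3"
    and null: "h \<cdot>\<^bsub>ad_mid T,ad_mid Ker3,ad_mid Cok1\<^esub> \<beta> \<in> adel_null C T Cok1"
  let ?t = "ad_mid T" and ?c = "ad_c T" and ?\<gamma> = "ad_gam T"
  note [simp] = adel_objD [OF T] adel_rep_hom [OF h, simplified]
  obtain s u where [simp]: "s \<in> hom ?t a" "u \<in> hom ?c c"
    and eq: "h \<cdot>\<^bsub>?t,b,c\<^esub> \<beta> = s \<cdot>\<^bsub>?t,a,c\<^esub> \<alpha> \<cdot>\<^bsub>a,b,c\<^esub> \<beta> \<boxplus>\<^bsub>?t,c\<^esub> ?\<gamma> \<cdot>\<^bsub>?t,?c,c\<^esub> u"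
    using adel_nullE [OF null] by auto
  let ?k = "h \<boxplus>\<^bsub>?t,b\<^esub> neg ?t b (s \<cdot>\<^bsub>?t,a,b\<^esub> \<alpha>)"
  have "?k \<cdot>\<^bsub>?t,b,c\<^esub> \<beta> = ?\<gamma> \<cdot>\<^bsub>?t,?c,c\<^esub> u"
    using sub_eq_of_eq_add(1) [OF _ _ eq] by (simp add: add_comp comp_assoc)
  moreover have "h = s \<cdot>\<^bsub>?t,a,b\<^esub> \<alpha> \<boxplus>\<^bsub>?t,b\<^esub> ?k"
    by (simp add: add_left_comm [of "s \<cdot>\<^bsub>?t,a,b\<^esub> \<alpha>"])
  ultimately show "in_adel_image C Ker2 Ker3 (one b) T h"
    by (intro in_adel_imageI [where a = s and a' = ?k and b = "zero ?c b" and b' = u]) simp_all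
qed simp_all

text \<open>
  The argument at \<open>Ker2\<close>, one step further along the chain: \<open>s\<beta>\<gamma> = (h - \<gamma>\<^sub>t u)\<gamma> = \<gamma>\<^sub>t(\<psi> - u\<gamma>)\<close>.
\<close>

lemma snake_exact_Cok1:
  "exact_at (adel C) Ker3 Cok1 Cok2 (adel_class C Ker3 Cok1 \<beta>) (adel_class C Cok1 Cok2 (one c))"
proof (rule adel_exactI)
  show "\<beta> \<cdot>\<^bsub>ad_mid Ker3,ad_mid Cok1,ad_mid Cok2\<^esub> one c \<in> adel_null C Ker3 Cok2"
    by (rule adel_nullI [where a = "one b" and b = "zero d c"]) simp_all
  fix T h assume T: "T \<in> adel_obj C" and h: "h \<in> adel_rep C T Cok1"
    and null: "h \<cdot>\<^bsub>ad_mid T,ad_mid Cok1,ad_mid Cok2\<^esub> one c \<in> adel_null C T Cok2"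
  let ?t = "ad_mid T" and ?c = "ad_c T" and ?\<gamma> = "ad_gam T"
  note [simp] = adel_objD [OF T] adel_rep_hom [OF h, simplified]
  obtain s u where [simp]: "s \<in> hom ?t b" "u \<in> hom ?c c"
    and h_eq: "h = s \<cdot>\<^bsub>?t,b,c\<^esub> \<beta> \<boxplus>\<^bsub>?t,c\<^esub> ?\<gamma> \<cdot>\<^bsub>?t,?c,c\<^esub> u"
    using adel_nullE [OF null] by auto
  obtain \<psi> where [simp]: "\<psi> \<in> hom ?c d" and \<psi>: "?\<gamma> \<cdot>\<^bsub>?t,?c,d\<^esub> \<psi> = h \<cdot>\<^bsub>?t,c,d\<^esub> \<gamma>"
    using adel_repE [OF h] by auto
  have "?\<gamma> \<cdot>\<^bsub>?t,?c,d\<^esub> \<psi> = s \<cdot>\<^bsub>?t,b,d\<^esub> \<beta> \<cdot>\<^bsub>b,c,d\<^esub> \<gamma> \<boxplus>\<^bsub>?t,d\<^esub> ?\<gamma> \<cdot>\<^bsub>?t,?c,d\<^esub> u \<cdot>\<^bsub>?c,c,d\<^esub> \<gamma>"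
    unfolding \<psi> h_eq by (simp add: add_comp comp_assoc)
  then have "s \<cdot>\<^bsub>?t,b,d\<^esub> \<beta> \<cdot>\<^bsub>b,c,d\<^esub> \<gamma> =
      ?\<gamma> \<cdot>\<^bsub>?t,?c,d\<^esub> (\<psi> \<boxplus>\<^bsub>?c,d\<^esub> neg ?c d (u \<cdot>\<^bsub>?c,c,d\<^esub> \<gamma>))"
    using sub_eq_of_eq_add(2) [of "s \<cdot>\<^bsub>?t,b,d\<^esub> \<beta> \<cdot>\<^bsub>b,c,d\<^esub> \<gamma>" ?t d "?\<gamma> \<cdot>\<^bsub>?t,?c,d\<^esub> u \<cdot>\<^bsub>?c,c,d\<^esub> \<gamma>"]
    by (simp add: comp_add)
  then show "in_adel_image C Ker3 Cok1 \<beta> T h"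
    by (intro in_adel_imageI [where a = "zero ?t a" and a' = s and b = u
          and b' = "\<psi> \<boxplus>\<^bsub>?c,d\<^esub> neg ?c d (u \<cdot>\<^bsub>?c,c,d\<^esub> \<gamma>)"]) (simp_all add: h_eq)
qed simp_all

text \<open>
  The argument at \<open>Ker3\<close>, one step further along the chain: \<open>k = h - s\<beta>\<close>.
\<close>

lemma snake_exact_Cok2:
  "exact_at (adel C) Cok1 Cok2 Cok3 (adel_class C Cok1 Cok2 (one c)) (adel_class C Cok2 Cok3 \<gamma>)"
proof (rule adel_exactI)
  show "one c \<cdot>\<^bsub>ad_mid Cok1,ad_mid Cok2,ad_mid Cok3\<^esub> \<gamma> \<in> adel_null C Cok1 Cok3"
    by (rule adel_nullI [where a = "zero c b" and b = "one d"]) simp_all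
  fix T h assume T: "T \<in> adel_obj C" and h: "h \<in> adel_rep C T Cok2"
    and null: "h \<cdot>\<^bsub>ad_mid T,ad_mid Cok2,ad_mid Cok3\<^esub> \<gamma> \<in> adel_null C T Cok3"
  let ?t = "ad_mid T" and ?c = "ad_c T" and ?\<gamma> = "ad_gam T"
  note [simp] = adel_objD [OF T] adel_rep_hom [OF h, simplified]
  obtain s u where [simp]: "s \<in> hom ?t b" "u \<in> hom ?c d"
    and eq: "h \<cdot>\<^bsub>?t,c,d\<^esub> \<gamma> = s \<cdot>\<^bsub>?t,b,d\<^esub> \<beta> \<cdot>\<^bsub>b,c,d\<^esub> \<gamma> \<boxplus>\<^bsub>?t,d\<^esub> ?\<gamma> \<cdot>\<^bsub>?t,?c,d\<^esub> u"
    using adel_nullE [OF null] by auto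
  let ?k = "h \<boxplus>\<^bsub>?t,c\<^esub> neg ?t c (s \<cdot>\<^bsub>?t,b,c\<^esub> \<beta>)"
  have "?k \<cdot>\<^bsub>?t,c,d\<^esub> \<gamma> = ?\<gamma> \<cdot>\<^bsub>?t,?c,d\<^esub> u"
    using sub_eq_of_eq_add(1) [OF _ _ eq] by (simp add: add_comp comp_assoc)
  moreover have "h = s \<cdot>\<^bsub>?t,b,c\<^esub> \<beta> \<boxplus>\<^bsub>?t,c\<^esub> ?k"
    by (simp add: add_left_comm [of "s \<cdot>\<^bsub>?t,b,c\<^esub> \<beta>"])
  ultimately show "in_adel_image C Cok1 Cok2 (one c) T h"
    by (intro in_adel_imageI [where a = s and a' = ?k and b = "zero ?c c" and b' = u]) simp_all
qed simp_all

end


section \<open>The snake diagram of the quiver\<close>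

interpretation P: preadditive_category "path_cat snake_quiver snake_rel"
  by (rule preadditive_path_cat)

interpretation A: additive_category snakeA
  unfolding snakeA_def by (rule P.additive_add_closure)

lemma snakeA_obj [simp]: "cobj snakeA = UNIV"
  by (simp add: snakeA_def add_closure_def snake_quiver_def)

lemma qpath_arrow: "qpath snake_quiver (src snake_quiver f) [f] (tgt snake_quiver f)"
  by (simp add: snake_quiver_def)

lemma arrow_mor_hom: "arrow_mor f \<in> chom snakeA [src snake_quiver f] [tgt snake_quiver f]"
  using lin_paths_of [OF qpath_arrow]
  by (auto simp: snakeA_def P.add_closure_hom_iff arrow_mor_def path_cat_hom_iff)

lemma snake_arrows_hom [simp]:
  "m_al \<in> chom snakeA [Na] [Nb]" "m_be \<in> chom snakeA [Nb] [Nc]" "m_ga \<in> chom snakeA [Nc] [Nd]"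
  using arrow_mor_hom [of Alpha] arrow_mor_hom [of Beta] arrow_mor_hom [of Gamma]
  by (simp_all add: snake_quiver_def)

lemma single_entry_comp:
  assumes "f \<in> lin_paths snake_quiver x y" "g \<in> lin_paths snake_quiver y z"
  shows "ccomp snakeA [x] [y] [z]
      (mat 1 1 (\<lambda>_. path_class snake_quiver snake_rel x y f))
      (mat 1 1 (\<lambda>_. path_class snake_quiver snake_rel y z g)) =
    mat 1 1 (\<lambda>_. path_class snake_quiver snake_rel x z (path_mult f g))"
proof -
  have "path_class snake_quiver snake_rel x z (path_mult f g) \<in> chom (path_cat snake_quiver snake_rel) x z"
    using lin_paths_mult [OF assms] by (auto simp: path_cat_hom_iff)
  then show ?thesis
    unfolding snakeA_def
    using P.add_closure_comp_carrier [of "[x]" "[y]" "[z]"]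
    by (intro P.add_closure_eqI [of _ "[x]" "[z]"])
       (simp_all add: P.add_closure_comp_index path_class_comp [OF assms])
qed

lemma snake_relation: "ccomp snakeA [Na] [Nb] [Nd] m_al m_bega = czero snakeA [Na] [Nd]"
proof -
  let ?c = "path_class snake_quiver snake_rel"
  have lin: "frag_of [Alpha] \<in> lin_paths snake_quiver Na Nb"
    "frag_of [Beta] \<in> lin_paths snake_quiver Nb Nc" "frag_of [Gamma] \<in> lin_paths snake_quiver Nc Nd"
    "frag_of [Beta, Gamma] \<in> lin_paths snake_quiver Nb Nd"
    "frag_of [Alpha, Beta, Gamma] \<in> lin_paths snake_quiver Na Nd"
    by (simp_all add: snake_quiver_def)
  have "rel_ideal snake_quiver snake_rel Na Nd (frag_of [Alpha, Beta, Gamma])"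
    by (rule rel_ideal.gen) (simp add: snake_rel_def)
  then have "?c Na Nd (frag_of [Alpha, Beta, Gamma]) = ?c Na Nd 0"
    using lin by (simp add: path_class_eq_iff)
  moreover have "ccomp snakeA [Na] [Nb] [Nd] m_al m_bega =
      mat 1 1 (\<lambda>_. ?c Na Nd (frag_of [Alpha, Beta, Gamma]))"
    using single_entry_comp [OF lin(2,3)] single_entry_comp [OF lin(1,4)]
    by (simp add: arrow_mor_def snake_quiver_def)
  moreover have "czero snakeA [Na] [Nd] = mat 1 1 (\<lambda>_. ?c Na Nd 0)"
    by (rule eq_matI) (auto simp: snakeA_def add_closure_def path_cat_zero)
  ultimately show ?thesis
    by simp
qed

interpretation S: snake_chain snakeA "[]" "[Na]" "[Nb]" "[Nc]" "[Nd]" m_al m_be m_ga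
  by unfold_locales simp_all

lemma cid_Nil: "cid snakeA [] = czero snakeA [] []"
  by (rule eq_matI) (auto simp: snakeA_def add_closure_def)

lemma albe_ga: "ccomp snakeA [Na] [Nc] [Nd] m_albe m_ga = czero snakeA [Na] [Nd]"
  by (simp add: A.comp_assoc snake_relation)

lemma snake_shape_simps [simp]:
  "nodes snake_shape = UNIV" "src snake_shape (m, \<phi>, n) = m" "tgt snake_shape (m, \<phi>, n) = n"
  by (simp_all add: snake_shape_def)

lemma snake_ob_adel [simp]: "snake_ob n \<in> adel_obj snakeA"
  by (cases n) (simp_all add: adel_obj_def)

text \<open>
  The columns are the sequences of \<open>\<alpha>\<beta>\<close>, \<open>\<beta>\<close> and \<open>\<beta>\<gamma>\<close>. The upper row is the second half of the sequence
  of \<open>\<alpha>\<close>, since \<open>(a \<rightarrow> b \<rightarrow> 0)\<close> is the cokernel of \<open>\<alpha>\<close>, and the lower row is the first half of the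
  sequence of \<open>\<gamma>\<close>.
\<close>

lemmas first_column = A.kernel_cokernel_sequence
  [of "[]" "[Na]" "[Nc]" "[Nd]" "[]" "czero snakeA [] [Na]" m_albe m_ga]
lemmas second_column = A.kernel_cokernel_sequence
  [of "[]" "[Nb]" "[Nc]" "[]" "[]" "czero snakeA [] [Nb]" m_be "czero snakeA [Nc] []"]
lemmas third_column = A.kernel_cokernel_sequence
  [of "[Na]" "[Nb]" "[Nd]" "[]" "[]" m_al m_bega "czero snakeA [Nd] []"]
lemmas upper_row_sequence = A.kernel_cokernel_sequence
  [of "[]" "[Na]" "[Nb]" "[]" "[]" "czero snakeA [] [Na]" m_al "czero snakeA [Nb] []"]
lemmas lower_row_sequence = A.kernel_cokernel_sequence
  [of "[]" "[Nc]" "[Nd]" "[]" "[]" "czero snakeA [] [Nc]" m_ga "czero snakeA [Nd] []"]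

lemma snake_arrow_rep:
  assumes "(m, \<phi>, n) \<in> arrows snake_shape"
  shows "\<phi> \<in> adel_rep snakeA (snake_ob m) (snake_ob n)"
proof -
  have zero: "czero snakeA (ad_mid (snake_ob m)) (ad_mid (snake_ob n)) \<in>
      adel_rep snakeA (snake_ob m) (snake_ob n)" for m n
    by simp
  have "czero snakeA [Nb] [] \<in> adel_rep snakeA (snake_ob U3) (snake_ob ZU)"
    "czero snakeA [] [Nc] \<in> adel_rep snakeA (snake_ob ZL) (snake_ob L1)"
    "czero snakeA [] [Na] \<in> adel_rep snakeA (snake_ob Zt1) (snake_ob K1)"
    "czero snakeA [] [Nb] \<in> adel_rep snakeA (snake_ob Zt2) (snake_ob K2)"
    "czero snakeA [] [Nb] \<in> adel_rep snakeA (snake_ob Zt3) (snake_ob K3)"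
    "czero snakeA [Nc] [] \<in> adel_rep snakeA (snake_ob C1) (snake_ob Zb1)"
    "czero snakeA [Nc] [] \<in> adel_rep snakeA (snake_ob C2) (snake_ob Zb2)"
    "czero snakeA [Nd] [] \<in> adel_rep snakeA (snake_ob C3) (snake_ob Zb3)"
    using zero [of U3 ZU] zero [of ZL L1] zero [of Zt1 K1] zero [of Zt2 K2] zero [of Zt3 K3]
      zero [of C1 Zb1] zero [of C2 Zb2] zero [of C3 Zb3] by simp_all
  moreover have "cid snakeA [Na] \<in> adel_rep snakeA (snake_ob K1) (snake_ob U1)"
    "m_albe \<in> adel_rep snakeA (snake_ob U1) (snake_ob L1)"
    "cid snakeA [Nc] \<in> adel_rep snakeA (snake_ob L1) (snake_ob C1)"
    using first_column(1-3) by (simp_all add: albe_ga)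
  moreover have "cid snakeA [Nb] \<in> adel_rep snakeA (snake_ob K2) (snake_ob U2)"
    "m_be \<in> adel_rep snakeA (snake_ob U2) (snake_ob L2)"
    "cid snakeA [Nc] \<in> adel_rep snakeA (snake_ob L2) (snake_ob C2)"
    using second_column(1-3) by simp_all
  moreover have "cid snakeA [Nb] \<in> adel_rep snakeA (snake_ob K3) (snake_ob U3)"
    "m_bega \<in> adel_rep snakeA (snake_ob U3) (snake_ob L3)"
    "cid snakeA [Nd] \<in> adel_rep snakeA (snake_ob L3) (snake_ob C3)"
    using third_column(1-3) by (simp_all add: snake_relation)
  moreover have "m_al \<in> adel_rep snakeA (snake_ob U1) (snake_ob U2)"
    "cid snakeA [Nb] \<in> adel_rep snakeA (snake_ob U2) (snake_ob U3)"
    "cid snakeA [Nc] \<in> adel_rep snakeA (snake_ob L1) (snake_ob L2)"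
    "m_ga \<in> adel_rep snakeA (snake_ob L2) (snake_ob L3)"
    using upper_row_sequence(2,3) lower_row_sequence(1,2) by simp_all
  moreover have "m_al \<in> adel_rep snakeA (snake_ob K1) (snake_ob K2)"
    "cid snakeA [Nb] \<in> adel_rep snakeA (snake_ob K2) (snake_ob K3)"
    "m_be \<in> adel_rep snakeA (snake_ob K3) (snake_ob C1)"
    "cid snakeA [Nc] \<in> adel_rep snakeA (snake_ob C1) (snake_ob C2)"
    "m_ga \<in> adel_rep snakeA (snake_ob C2) (snake_ob C3)"
    using S.snake_reps by simp_all
  ultimately show ?thesis
    using assms by (auto simp: snake_shape_def simp del: snake_ob.simps)
qed

text \<open>
  The morphism given by the unique path of the quiver from \<open>x\<close> to \<open>y\<close>, and zero if there is none. The
  path from \<open>Na\<close> to \<open>Nd\<close> is the relation, so it falls under the last equation.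
\<close>

fun quiver_mor :: "snode \<Rightarrow> snode \<Rightarrow> smor" where
  "quiver_mor Na Na = cid snakeA [Na]"
| "quiver_mor Nb Nb = cid snakeA [Nb]"
| "quiver_mor Nc Nc = cid snakeA [Nc]"
| "quiver_mor Nd Nd = cid snakeA [Nd]"
| "quiver_mor Na Nb = m_al"
| "quiver_mor Nb Nc = m_be"
| "quiver_mor Nc Nd = m_ga"
| "quiver_mor Na Nc = m_albe"
| "quiver_mor Nb Nd = m_bega"
| "quiver_mor x y = czero snakeA [x] [y]"

fun canonical_mor :: "snode list \<Rightarrow> snode list \<Rightarrow> smor" where
  "canonical_mor [x] [y] = quiver_mor x y"
| "canonical_mor xs ys = czero snakeA xs ys"

text \<open>
  Paths of the quiver ascend in \<open>height\<close>. Canonical morphisms compose only along ascending nodes: going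
  up and back down again gives zero, whereas the canonical morphism from a node to itself is the
  identity.
\<close>

primrec height :: "snode \<Rightarrow> nat" where
  "height Na = 0" | "height Nb = 1" | "height Nc = 2" | "height Nd = 3"

lemma quiver_mor_hom [simp]: "quiver_mor x y \<in> chom snakeA [x] [y]"
  by (cases x; cases y; simp)

lemma quiver_mor_comp:
  "height x \<le> height y \<Longrightarrow> height y \<le> height z \<Longrightarrow>
     ccomp snakeA [x] [y] [z] (quiver_mor x y) (quiver_mor y z) = quiver_mor x z"
  by (cases x; cases y; cases z; simp add: albe_ga snake_relation)

lemma snake_mid_cases: "ad_mid (snake_ob n) = [] \<or> (\<exists>x. ad_mid (snake_ob n) = [x])"
  by (cases n) simp_all

definition precedes :: "pos \<Rightarrow> pos \<Rightarrow> bool" where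
  "precedes m n \<longleftrightarrow> (\<forall>x y. ad_mid (snake_ob m) = [x] \<longrightarrow> ad_mid (snake_ob n) = [y] \<longrightarrow>
     height x \<le> height y)"

lemma snake_arrow_canonical:
  assumes "(m, \<phi>, n) \<in> arrows snake_shape"
  shows "\<phi> = canonical_mor (ad_mid (snake_ob m)) (ad_mid (snake_ob n))" "precedes m n"
  using assms unfolding snake_shape_def precedes_def by auto

text \<open>
  A path in the diagram meets a zero object only at its ends. Otherwise its composite would be zero,
  while a parallel path may have a nonzero one.
\<close>

lemma snake_sink:
  assumes "(m, \<phi>, n) \<in> arrows snake_shape" "ad_mid (snake_ob n) = []" "(n, \<psi>, k) \<in> arrows snake_shape"
  shows False
  using assms unfolding snake_shape_def by auto

text \<open>
  The invariant that makes the induction on the path work also records that the canonical morphism is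
  a representative, which lets classes be composed, and that the end points ascend, which lets
  canonical morphisms be composed.
\<close>

lemma snake_composite:
  assumes "qpath snake_shape m p n"
  shows "canonical_mor (ad_mid (snake_ob m)) (ad_mid (snake_ob n)) \<in>
      adel_rep snakeA (snake_ob m) (snake_ob n) \<and> precedes m n \<and>
    composite (adel snakeA) snake_shape snake_ob snake_mor m p n =
      adel_class snakeA (snake_ob m) (snake_ob n)
        (canonical_mor (ad_mid (snake_ob m)) (ad_mid (snake_ob n)))"
  using assms
proof (induction p arbitrary: m)
  case Nil
  then have [simp]: "n = m"
    by simp
  have can: "canonical_mor (ad_mid (snake_ob m)) (ad_mid (snake_ob m)) = cid snakeA (ad_mid (snake_ob m))"
    by (cases m) (simp_all add: cid_Nil)
  moreover have "cid snakeA (ad_mid (snake_ob m)) \<in> adel_rep snakeA (snake_ob m) (snake_ob m)"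
    by (rule A.adel_repI [where \<omega> = "cid snakeA (ad_r (snake_ob m))" and
          \<psi> = "cid snakeA (ad_c (snake_ob m))"])
       (use adel_objD [OF snake_ob_adel, of m] in simp_all)
  ultimately show ?case
    by (simp add: precedes_def)
next
  case (Cons e p)
  obtain \<phi> k where e: "e = (m, \<phi>, k)" "(m, \<phi>, k) \<in> arrows snake_shape"
    and p: "qpath snake_shape k p n"
    using Cons.prems by (cases e) auto
  let ?m = "ad_mid (snake_ob m)" and ?k = "ad_mid (snake_ob k)" and ?n = "ad_mid (snake_ob n)"
  note IH = Cons.IH [OF p]
  note arr = snake_arrow_rep [OF e(2)] snake_arrow_canonical [OF e(2)]
  have "ccomp snakeA ?m ?k ?n (canonical_mor ?m ?k) (canonical_mor ?k ?n) = canonical_mor ?m ?n \<and>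
    precedes m n"
  proof (cases "?k = []")
    case True
    have "n = k"
    proof (cases p)
      case (Cons e' p')
      then have "e' \<in> arrows snake_shape" "src snake_shape e' = k"
        using p by auto
      then show ?thesis
        using snake_sink [OF e(2) True] by (cases e') auto
    qed (use p in simp)
    then show ?thesis
      using True snake_mid_cases [of m] by (auto simp: precedes_def)
  next
    case False
    then obtain y where y: "?k = [y]"
      using snake_mid_cases [of k] by auto
    show ?thesis
      using snake_mid_cases [of m] snake_mid_cases [of n] y arr(3) IH
      by (auto simp: precedes_def quiver_mor_comp intro: order_trans)
  qed
  moreover have "composite (adel snakeA) snake_shape snake_ob snake_mor m (e # p) n =
      adel_class snakeA (snake_ob m) (snake_ob n)
        (ccomp snakeA ?m ?k ?n (canonical_mor ?m ?k) (canonical_mor ?k ?n))"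
    using IH arr by (simp add: e(1) snake_mor_def)
  moreover have "ccomp snakeA ?m ?k ?n (canonical_mor ?m ?k) (canonical_mor ?k ?n) \<in>
      adel_rep snakeA (snake_ob m) (snake_ob n)"
    using A.adel_rep_comp [OF snake_ob_adel snake_ob_adel snake_ob_adel, of "canonical_mor ?m ?k" m k]
      IH arr(1) unfolding arr(2) by blast
  ultimately show ?case
    by simp
qed

theorem lemma2p7:
  "(\<forall>n. snake_ob n \<in> cobj (adel snakeA)) \<and>
   (\<forall>(m, \<phi>, n) \<in> arrows snake_shape. \<phi> \<in> adel_rep snakeA (snake_ob m) (snake_ob n)) \<and>
   commutes (adel snakeA) snake_shape snake_ob snake_mor \<and>
   exact_seq upper_row \<and> exact_seq lower_row \<and>
   exact_seq column1 \<and> exact_seq column2 \<and> exact_seq column3 \<and>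
   exact_seq snake_seq"
proof (intro conjI)
  show "\<forall>n. snake_ob n \<in> cobj (adel snakeA)"
    by simp
  show "\<forall>(m, \<phi>, n) \<in> arrows snake_shape. \<phi> \<in> adel_rep snakeA (snake_ob m) (snake_ob n)"
    using snake_arrow_rep by blast
  show "commutes (adel snakeA) snake_shape snake_ob snake_mor"
    unfolding commutes_def using snake_composite by metis
  note seq = exact_seq.simps snake_shape_simps snake_mor_def prod.case snake_ob.simps
  show "exact_seq upper_row"
    using upper_row_sequence(6,7) by (simp add: seq)
  show "exact_seq lower_row"
    using lower_row_sequence(4,5) by (simp add: seq)
  show "exact_seq column1"
    using first_column(4-7) by (simp add: seq albe_ga)
  show "exact_seq column2"
    using second_column(4-7) by (simp add: seq)
  show "exact_seq column3"
    using third_column(4-7) by (simp add: seq snake_relation)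
  show "exact_seq snake_seq"
    using S.snake_exact_Ker2 S.snake_exact_Ker3 S.snake_exact_Cok1 S.snake_exact_Cok2
    by (simp add: seq)
qed

end
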